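(* Consider the saddle-point problem (SP) $\min_{x_1\in\mathcal{X}_1}\max_{x_2\in\mathcal{X}_2} f(x_1,x_2)$ described in the context, assume it is strictly coherent, and run the stochastic optimistic mirror descent algorithm $$Y_n=P_{X_n}(-\gamma_n\hat g_n),\qquad X_{n+1}=P_{X_n}(-\gamma_n\hat r_n),$$ with a gradient oracle satisfying $$\mathbb{E}[\hat g_n\mid\mathcal{F}_{n,n-1}]=g(X_n),\quad \mathbb{E}[\hat r_n\mid\mathcal{F}_{n,n}]=g(Y_n),\quad \mathbb{E}[\|\hat g_n\|_*^2\mid\mathcal{F}_{n,n-1}]\le G^2,\quad \mathbb{E}[\|\hat r_n\|_*^2\mid\mathcal{F}_{n,n}]\le G^2,$$ where $\mathcal{F}_{n_1,n_2}=\sigma(X_1,\dots,X_{n_1},Y_1,\dots,Y_{n_2})$ and $G\in[0,\infty)$. Let $\sigma$ be a finite constant with $\mathbb{E}[\|\hat g_n-g(X_n)\|_*^2\mid\mathcal{F}_{n,n-1}]\le\sigma^2$ and $\mathbb{E}[\|\hat r_n-g(Y_n)\|_*^2\mid\mathcal{F}_{n,n}]\le\sigma^2$ for all $n$. Then for any $\epsilon>0$ and $\delta\in(0,1)$, if the step-sizes satisfy $\sum_{n=1}^\infty\gamma_n=\infty$ and $$\sum_{n=1}^\infty\gamma_n^2\le\min\left\{\frac{\delta\epsilon^2}{3\,\mathrm{diam}(\mathcal{X})^2\sigma^2},\ \frac{K\delta\epsilon}{3\sigma^2}\right\},$$ where $\mathrm{diam}(\mathcal{X})=\sup_{x,y\in\mathcal{X}}\|x-y\|$,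 then $$\mathbb{P}\Big(\exists n_0\in\mathbb{N},\ \exists x^*\in\mathcal{X}^* \text{ s.t. } D(x^*,X_n)\le\epsilon\ \forall n\ge n_0\Big)\ge1-\delta.$$
   Context: Let $\mathcal{V}_i=\mathbb{R}^{d_i}$ ($i=1,2$) be finite-dimensional normed spaces, $\mathcal{X}_i\subset\mathcal{V}_i$ compact convex sets, $\mathcal{X}=\mathcal{X}_1\times\mathcal{X}_2\subset\mathcal{V}=\mathcal{V}_1\times\mathcal{V}_2$ with norm $\|\cdot\|$ and dual norm $\|\cdot\|_*$. Let $f:\mathcal{X}\to\mathbb{R}$ be continuously differentiable and $g(x)=(\nabla_{x_1}f(x_1,x_2),-\nabla_{x_2}f(x_1,x_2))\in\mathcal{V}^*$. Let $\mathcal{X}^*$ be the set of solutions (saddle points) of (SP). A point $x^*$ solves (SVI) if $\langle g(x^* ),x-x^*\rangle\ge0$ for all $x\in\mathcal{X}$, and satisfies (MVI) if $\langle g(x),x-x^*\rangle\ge0$ for all $x\in\mathcal{X}$. (SP) is coherent if: (1) every solution of (SVI) solves (SP); (2) there is a solution $p$ of (SP) satisfying (MVI); (3) for some fixed $\epsilon_0>0$, every solution $x^*$ of (SP) satisfies $\langle g(x),x-x^*\rangle\ge0$ for all $x\in\mathcal{X}$ with $D(x^*,x)\le\epsilon_0$. It is strictly coherent if moreover in (2) the inequality $\langle g(x),x-p\rangle>0$ is strict whenever $x$ is not a solution of (SP). Fix a differentiable function $h$ with domain containing $\mathcal{X}$, $K$-strongly convex: $\langle\nabla h(x)-\nabla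 h(x'),x-x'\rangle\ge K\|x-x'\|^2$, with $\nabla h$ $L_h$-Lipschitz. Bregman divergence: $D(p,x)=h(p)-h(x)-\langle\nabla h(x),p-x\rangle$, assumed to satisfy Bregman reciprocity ($D(p,x_n)\to0$ whenever $x_n\to p$). Prox-mapping: $P_x(y)=\arg\min_{x'\in\mathcal{X}}\{\langle y,x-x'\rangle+D(x',x)\}$ for $y\in\mathcal{V}^*$. All random objects live on a probability space $(\Omega,\mathcal{F},\mathbb{P})$. *)

theory Defs
  imports "HOL-Analysis.Analysis" "HOL-Probability.Probability"
begin

definition is_norm :: "('v::real_vector \<Rightarrow> real) \<Rightarrow> bool" where
  "is_norm nrm \<longleftrightarrow> (\<forall>x. nrm x \<ge> 0) \<and> (\<forall>x. nrm x = 0 \<longleftrightarrow> x = 0) \<and>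
     (\<forall>x y. nrm (x + y) \<le> nrm x + nrm y) \<and> (\<forall>c x. nrm (c *\<^sub>R x) = \<bar>c\<bar> * nrm x)"

text \<open>Dual norm; the dual space is identified with the space itself via the standard pairing
  (inner product), so that the pairing of y with x is y \<bullet> x.\<close>
definition dual_norm :: "('v::real_inner \<Rightarrow> real) \<Rightarrow> 'v \<Rightarrow> real" where
  "dual_norm nrm y = Sup {y \<bullet> x | x. nrm x \<le> 1}"

definition diam_nrm :: "('v::real_vector \<Rightarrow> real) \<Rightarrow> 'v set \<Rightarrow> real" where
  "diam_nrm nrm S = Sup {nrm (x - y) | x y. x \<in> S \<and> y \<in> S}"

definition sp_field :: "('a \<times> 'b \<Rightarrow> 'a \<times> 'b) \<Rightarrow> 'a \<times> 'b \<Rightarrow> ('a::real_vector) \<times> ('b::real_vector)" where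
  "sp_field fgrad x = (fst (fgrad x), - snd (fgrad x))"

definition saddle_points :: "('a \<times> 'b \<Rightarrow> real) \<Rightarrow> 'a set \<Rightarrow> 'b set \<Rightarrow> ('a \<times> 'b) set" where
  "saddle_points f X1 X2 = {(a, b). a \<in> X1 \<and> b \<in> X2 \<and>
      (\<forall>x1\<in>X1. \<forall>x2\<in>X2. f (a, x2) \<le> f (a, b) \<and> f (a, b) \<le> f (x1, b))}"

definition SVI_solution :: "('v \<Rightarrow> 'v::real_inner) \<Rightarrow> 'v set \<Rightarrow> 'v \<Rightarrow> bool" where
  "SVI_solution g X x \<longleftrightarrow> x \<in> X \<and> (\<forall>x'\<in>X. g x \<bullet> (x' - x) \<ge> 0)"

definition bregman :: "('v \<Rightarrow> real) \<Rightarrow> ('v \<Rightarrow> 'v::real_inner) \<Rightarrow> 'v \<Rightarrow> 'v \<Rightarrow> real" where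
  "bregman h gh p x = h p - h x - gh x \<bullet> (p - x)"

definition prox :: "'v set \<Rightarrow> ('v \<Rightarrow> real) \<Rightarrow> ('v \<Rightarrow> 'v::real_inner) \<Rightarrow> 'v \<Rightarrow> 'v \<Rightarrow> 'v" where
  "prox X h gh x y = (SOME x'. x' \<in> X \<and>
     (\<forall>z\<in>X. y \<bullet> (x - x') + bregman h gh x' x \<le> y \<bullet> (x - z) + bregman h gh z x))"

definition strictly_coherent ::
  "('a \<times> 'b \<Rightarrow> real) \<Rightarrow> ('a \<times> 'b \<Rightarrow> ('a::real_inner) \<times> ('b::real_inner)) \<Rightarrow> 'a set \<Rightarrow> 'b set
     \<Rightarrow> ('a \<times> 'b \<Rightarrow> 'a \<times> 'b \<Rightarrow> real) \<Rightarrow> bool" where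
  "strictly_coherent f g X1 X2 D \<longleftrightarrow>
     (\<forall>x. SVI_solution g (X1 \<times> X2) x \<longrightarrow> x \<in> saddle_points f X1 X2) \<and>
     (\<exists>p\<in>saddle_points f X1 X2. \<forall>x\<in>X1 \<times> X2.
         g x \<bullet> (x - p) \<ge> 0 \<and> (x \<notin> saddle_points f X1 X2 \<longrightarrow> g x \<bullet> (x - p) > 0)) \<and>
     (\<exists>\<epsilon>0>0. \<forall>xs\<in>saddle_points f X1 X2. \<forall>x\<in>X1 \<times> X2.
         D xs x \<le> \<epsilon>0 \<longrightarrow> g x \<bullet> (x - xs) \<ge> 0)"

definition genF :: "'w measure \<Rightarrow> (nat \<Rightarrow> 'w \<Rightarrow> 'v::topological_space) \<Rightarrow> (nat \<Rightarrow> 'w \<Rightarrow> 'v)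
     \<Rightarrow> nat \<Rightarrow> nat \<Rightarrow> 'w measure" where
  "genF M X Y n1 n2 = sigma (space M)
     ((\<Union>i\<in>{1..n1}. {X i -` A \<inter> space M | A. A \<in> sets borel}) \<union>
      (\<Union>j\<in>{1..n2}. {Y j -` A \<inter> space M | A. A \<in> sets borel}))"

definition cond_exp_is :: "'w measure \<Rightarrow> 'w measure \<Rightarrow> ('w \<Rightarrow> 'v::euclidean_space) \<Rightarrow> ('w \<Rightarrow> 'v) \<Rightarrow> bool" where
  "cond_exp_is M F Z W \<longleftrightarrow> integrable M Z \<and>
     (\<forall>b\<in>Basis. AE \<omega> in M. real_cond_exp M F (\<lambda>\<omega>. Z \<omega> \<bullet> b) \<omega> = W \<omega> \<bullet> b)"

end

theory Submission
  imports Defs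
begin

text \<open>The iterates converge almost surely to a saddle point, so the event has probability one.
  The noise need not be adapted to the filtration generated by \<open>X\<close> and \<open>Y\<close>, so its partial sums
  need not be martingales; instead one works with the Bregman divergences of the iterates, which are adapted.
  For the globally attracting saddle point \<open>p\<close>, taking expectations in the one-step inequality bounds
  \<open>\<Sum>n. \<gamma> n * E (g (Y n) \<bullet> (Y n - p))\<close>, and since \<open>\<Sum>n. \<gamma> n\<close> diverges, strictness gives an
  accumulation point among the saddle points. For every saddle point \<open>q\<close> the local inequality makes
  \<open>min (D q (X n)) (\<epsilon>0 / 2)\<close> a supermartingale up to errors \<open>O((\<gamma> n)\<^sup>2)\<close>, which
  almost surely upcrosses any given interval only finitely often. Applying this
  to a countable dense set of \<open>q\<close> shows that the accumulation point is the limit.\<close>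

section \<open>Dual norms\<close>

text \<open>The obstacle is a mismatch of points: the inequality at a saddle point \<open>q\<close>
  holds where \<open>D q\<close> is small, but the drift of a step starting at \<open>X n\<close>
  contains \<open>g\<close> at \<open>Y n\<close>, which may have left that neighbourhood.
  Truncating \<open>D q\<close> at half the radius leaves a margin. Crossing it forces
  \<open>Y n - X n\<close> to exceed a fixed length \<eta>, so the bounded loss is charged to the
  squared displacement divided by \<eta>^2, whose expectation is of order \<gamma>^2; with the step
  size in front the error is of third order. Thus no event has to be discarded to keep the iterates
  near \<open>q\<close>. Upcrossings are counted by hand because the one-step estimates come as
  integrals over events of the past, which is the form that a trading strategy consumes. All
  estimates use the Euclidean norm, so the given norm enters only through comparison constants.
  Measurability of the final event is a separate issue, since it quantifies over an uncountable set
  of saddle points.\<close>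

lemma is_norm_upper:
  fixes nrm :: "'v::euclidean_space \<Rightarrow> real"
  assumes "is_norm nrm"
  shows "\<exists>B>0. \<forall>x. nrm x \<le> B * norm x"
proof -
  have zero: "nrm 0 = 0" and pos: "\<And>x. nrm x \<ge> 0"
    and tri: "\<And>x y. nrm (x + y) \<le> nrm x + nrm y" and scale: "\<And>c x. nrm (c *\<^sub>R x) = \<bar>c\<bar> * nrm x"
    using assms unfolding is_norm_def by auto
  have sums: "nrm (\<Sum>b\<in>A. f b) \<le> (\<Sum>b\<in>A. nrm (f b))" if "finite A" for A :: "'v set" and f
    using that by (induction A) (auto simp: zero intro: order_trans[OF tri])
  have "nrm x \<le> ((\<Sum>b\<in>Basis. nrm b) + 1) * norm x" for x :: 'v
  proof -
    have "nrm x = nrm (\<Sum>b\<in>Basis. (x \<bullet> b) *\<^sub>R b)" by (simp add: euclidean_representation)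
    also have "\<dots> \<le> (\<Sum>b\<in>Basis. nrm ((x \<bullet> b) *\<^sub>R b))" by (rule sums) simp
    also have "\<dots> \<le> (\<Sum>b\<in>Basis. norm x * nrm b)"
      by (intro sum_mono) (auto simp: scale Basis_le_norm pos intro: mult_right_mono)
    also have "\<dots> = (\<Sum>b\<in>Basis. nrm b) * norm x" by (simp add: sum_distrib_left mult.commute)
    also have "\<dots> \<le> ((\<Sum>b\<in>Basis. nrm b) + 1) * norm x" by (simp add: mult_right_mono)
    finally show ?thesis .
  qed
  moreover have "(\<Sum>b\<in>Basis. nrm (b::'v)) + 1 > 0"
    using sum_nonneg[of Basis nrm] pos by fastforce
  ultimately show ?thesis by blast
qed

text \<open>By the upper bound \<open>nrm\<close> is Lipschitz, hence attains a minimum on the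
  compact Euclidean unit sphere; definiteness makes it positive and homogeneity extends the bound to
  all vectors.\<close>

lemma is_norm_lower:
  fixes nrm :: "'v::euclidean_space \<Rightarrow> real"
  assumes "is_norm nrm"
  shows "\<exists>c>0. \<forall>x. c * norm x \<le> nrm x"
proof -
  have zero: "\<And>x. nrm x = 0 \<longleftrightarrow> x = 0" and pos: "\<And>x. nrm x \<ge> 0"
    and tri: "\<And>x y. nrm (x + y) \<le> nrm x + nrm y" and scale: "\<And>c x. nrm (c *\<^sub>R x) = \<bar>c\<bar> * nrm x"
    using assms unfolding is_norm_def by auto
  obtain B where B: "B > 0" "\<And>x. nrm x \<le> B * norm x" using is_norm_upper[OF assms] by blast
  have diff: "nrm x - nrm y \<le> B * norm (x - y)" for x y
    using tri[of "x - y" y] B(2)[of "x - y"] by simp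
  have "\<bar>nrm x - nrm y\<bar> \<le> B * norm (x - y)" for x y
    using diff[of x y] diff[of y x] by (simp add: norm_minus_commute abs_le_iff)
  then have "B-lipschitz_on (sphere 0 1) nrm"
    using B(1) by (intro lipschitz_onI) (auto simp: dist_norm)
  then have "continuous_on (sphere 0 1) nrm" by (rule lipschitz_on_continuous_on)
  moreover have "sphere (0::'v) 1 \<noteq> {}" by simp
  ultimately obtain u where u: "u \<in> sphere 0 1" "\<And>x. x \<in> sphere 0 1 \<Longrightarrow> nrm u \<le> nrm x"
    using continuous_attains_inf[OF compact_sphere, of 0 1 nrm] by blast
  have "u \<noteq> 0" using u(1) by force
  then have "nrm u > 0" using pos[of u] zero[of u] by linarith
  moreover have "nrm u * norm x \<le> nrm x" for x
  proof (cases "x = 0")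
    case False
    have "nrm u \<le> nrm ((1 / norm x) *\<^sub>R x)" by (rule u(2)) (use False in simp)
    then show ?thesis using False by (simp add: scale field_simps)
  qed (use pos in simp)
  ultimately show ?thesis by blast
qed

context
  fixes nrm :: "'v::euclidean_space \<Rightarrow> real"
  assumes nrm: "is_norm nrm"
begin

text \<open>\<open>dual_norm\<close> is a real \<open>Sup\<close>, which says nothing about an
  unbounded set. The lower comparison constant makes the unit ball of \<open>nrm\<close> bounded,
  and Cauchy-Schwarz does the rest.\<close>

lemma bdd_above_dual_norm: "bdd_above {y \<bullet> x | x. nrm x \<le> 1}"
proof -
  obtain c where c: "c > 0" "\<And>x. c * norm x \<le> nrm x" using is_norm_lower[OF nrm] by blast
  have "y \<bullet> x \<le> norm y * (1 / c)" if "nrm x \<le> 1" for x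
  proof -
    have "norm x \<le> 1 / c" using c(2)[of x] that c(1) by (simp add: field_simps)
    then show ?thesis by (meson Cauchy_Schwarz_ineq2 abs_le_D1 mult_left_mono norm_ge_zero order_trans)
  qed
  then show ?thesis by (intro bdd_aboveI) auto
qed

lemma inner_le_dual_norm: "y \<bullet> x \<le> dual_norm nrm y * nrm x"
proof (cases "x = 0")
  case False
  then have pos: "nrm x > 0" using nrm unfolding is_norm_def by (metis order_le_less)
  have "nrm ((1 / nrm x) *\<^sub>R x) = \<bar>1 / nrm x\<bar> * nrm x" using nrm unfolding is_norm_def by blast
  then have "nrm ((1 / nrm x) *\<^sub>R x) \<le> 1" using pos by simp
  then have "y \<bullet> ((1 / nrm x) *\<^sub>R x) \<le> dual_norm nrm y"
    unfolding dual_norm_def by (intro cSup_upper bdd_above_dual_norm) blast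
  then show ?thesis using pos by (simp add: field_simps)
next
  case True
  moreover have "nrm 0 = 0" using nrm unfolding is_norm_def by blast
  ultimately show ?thesis by simp
qed

lemma dual_norm_nonneg: "dual_norm nrm y \<ge> 0"
proof -
  have "nrm 0 = 0" using nrm by (auto simp: is_norm_def)
  then have "y \<bullet> 0 \<le> dual_norm nrm y"
    unfolding dual_norm_def by (intro cSup_upper bdd_above_dual_norm CollectI exI[of _ 0]) auto
  then show ?thesis by simp
qed

text \<open>Pair \<open>y\<close> with itself. This turns the oracle's moment bounds and the
  Lipschitz condition on the gradient of \<open>h\<close>, both stated in the dual norm, into
  Euclidean ones.\<close>

lemma norm_le_dual_norm: "\<exists>B>0. \<forall>y. norm y \<le> B * dual_norm nrm y"
proof -
  obtain B where B: "B > 0" "\<And>x. nrm x \<le> B * norm x" using is_norm_upper[OF nrm] by blast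
  have "norm y \<le> B * dual_norm nrm y" for y
  proof (cases "y = 0")
    case False
    have "norm y * norm y = y \<bullet> y" by (simp add: norm_eq_sqrt_inner)
    also have "\<dots> \<le> dual_norm nrm y * nrm y" by (rule inner_le_dual_norm)
    also have "\<dots> \<le> dual_norm nrm y * (B * norm y)" by (intro mult_left_mono B dual_norm_nonneg)
    finally have "norm y * norm y \<le> (B * dual_norm nrm y) * norm y" by (simp add: ac_simps)
    then show ?thesis by (rule mult_right_le_imp_le) (use False in simp)
  qed (use B dual_norm_nonneg in simp)
  then show ?thesis using B(1) by blast
qed

text \<open>A supremum over an uncountable family need not be measurable, but this family of linear
  functionals is uniformly Lipschitz, so the supremum is Lipschitz and hence continuous.\<close>

lemma borel_measurable_dual_norm [measurable]: "dual_norm nrm \<in> borel_measurable borel"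
proof -
  obtain c where c: "c > 0" "\<And>x. c * norm x \<le> nrm x" using is_norm_lower[OF nrm] by blast
  have "nrm 0 = 0" using nrm unfolding is_norm_def by blast
  then have ex: "{y \<bullet> x |x. nrm x \<le> 1} \<noteq> {}" for y
    by (auto intro!: exI[of _ 0])
  have diff: "dual_norm nrm y - dual_norm nrm z \<le> 1 / c * norm (y - z)" for y z
  proof -
    have "y \<bullet> x \<le> dual_norm nrm z + 1 / c * norm (y - z)" if "nrm x \<le> 1" for x
    proof -
      have "norm x \<le> 1 / c" using c(2)[of x] that c(1) by (simp add: field_simps)
      then have "(y - z) \<bullet> x \<le> norm (y - z) * (1 / c)"
        by (meson Cauchy_Schwarz_ineq2 abs_le_D1 mult_left_mono norm_ge_zero order_trans)
      moreover have "z \<bullet> x \<le> dual_norm nrm z"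
        unfolding dual_norm_def using that by (intro cSup_upper bdd_above_dual_norm) blast
      ultimately show ?thesis by (simp add: inner_diff_left)
    qed
    then have "dual_norm nrm y \<le> dual_norm nrm z + 1 / c * norm (y - z)"
      unfolding dual_norm_def[of nrm y] by (intro cSup_least ex) auto
    then show ?thesis by simp
  qed
  have "\<bar>dual_norm nrm y - dual_norm nrm z\<bar> \<le> 1 / c * norm (y - z)" for y z
    using diff[of y z] diff[of z y] by (simp add: norm_minus_commute abs_le_iff)
  then have "(1/c)-lipschitz_on UNIV (dual_norm nrm)"
    using c(1) by (intro lipschitz_onI) (auto simp: dist_norm)
  then have "continuous_on UNIV (dual_norm nrm)" by (rule lipschitz_on_continuous_on)
  then show ?thesis by (rule borel_measurable_continuous_onI)
qed

end

section \<open>Bregman divergences and the prox-mapping\<close>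

text \<open>Strong monotonicity is put in Euclidean form, with the norm comparison absorbed into
  \<open>k\<close>. The derivative is taken within \<open>C\<close>, which may have empty interior,
  so later arguments differentiate only along segments inside \<open>C\<close>.\<close>

locale bregman_geometry =
  fixes C :: "'v::euclidean_space set" and h :: "'v \<Rightarrow> real" and dh :: "'v \<Rightarrow> 'v" and k :: real
  assumes compact_C: "compact C" and convex_C: "convex C"
    and h_deriv: "x \<in> C \<Longrightarrow> (h has_derivative (\<lambda>v. dh x \<bullet> v)) (at x within C)"
    and cont_dh: "continuous_on C dh"
    and k_pos: "k > 0"
    and strong_mono: "x \<in> C \<Longrightarrow> y \<in> C \<Longrightarrow> (dh x - dh y) \<bullet> (x - y) \<ge> k * (norm (x - y))\<^sup>2"
begin

abbreviation D :: "'v \<Rightarrow> 'v \<Rightarrow> real" where "D \<equiv> bregman h dh"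

lemma cont_h: "continuous_on C h"
  using h_deriv by (meson has_derivative_continuous_on)

lemma bounded_C: obtains B where "B \<ge> 0" "\<And>x y. x \<in> C \<Longrightarrow> y \<in> C \<Longrightarrow> norm (x - y) \<le> B"
proof -
  have "norm (x - y) \<le> diameter C" if "x \<in> C" "y \<in> C" for x y
    using diameter_bounded_bound[OF compact_imp_bounded[OF compact_C] that] by (simp add: dist_norm)
  then show thesis using that[of "diameter C"] diameter_ge_0[OF compact_imp_bounded[OF compact_C]] by blast
qed

lemma segment_in_C: "x \<in> C \<Longrightarrow> y \<in> C \<Longrightarrow> 0 \<le> t \<Longrightarrow> t \<le> 1 \<Longrightarrow> x + t *\<^sub>R (y - x) \<in> C"
  using convexD_alt[OF convex_C, of x y t] by (simp add: algebra_simps)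

lemma h_deriv_segment:
  assumes "x \<in> C" "y \<in> C" "t \<in> {0..1}"
  shows "((\<lambda>t. h (x + t *\<^sub>R (y - x))) has_real_derivative dh (x + t *\<^sub>R (y - x)) \<bullet> (y - x)) (at t within {0..1})"
proof -
  have "(h has_derivative (\<lambda>v. dh (x + t *\<^sub>R (y - x)) \<bullet> v))
      (at (x + t *\<^sub>R (y - x)) within (\<lambda>t. x + t *\<^sub>R (y - x)) ` {0..1})"
    by (rule has_derivative_subset[OF h_deriv]) (use assms segment_in_C in auto)
  moreover have "((\<lambda>t. x + t *\<^sub>R (y - x)) has_derivative (\<lambda>s. s *\<^sub>R (y - x))) (at t within {0..1})"
    by (auto intro!: derivative_eq_intros)
  ultimately have "((\<lambda>t. h (x + t *\<^sub>R (y - x))) has_derivative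
      (\<lambda>s. dh (x + t *\<^sub>R (y - x)) \<bullet> (s *\<^sub>R (y - x)))) (at t within {0..1})"
    by (rule has_derivative_in_compose[rotated])
  then show ?thesis by (simp add: has_field_derivative_def mult.commute[of _ "dh _ \<bullet> _"])
qed

text \<open>With the auxiliary function \<phi>, the claim is \<phi>(0) \<le> \<phi>(1), and strong
  monotonicity along the segment from \<open>x\<close> to \<open>p\<close> makes the derivative of
  \<phi> nonnegative.\<close>

lemma bregman_lower:
  assumes "p \<in> C" "x \<in> C"
  shows "k / 2 * (norm (p - x))\<^sup>2 \<le> D p x"
proof -
  define \<phi> where "\<phi> t = h (x + t *\<^sub>R (p - x)) - t * (dh x \<bullet> (p - x)) - k / 2 * t\<^sup>2 * (norm (p - x))\<^sup>2" for t
  define \<phi>' where "\<phi>' t = (dh (x + t *\<^sub>R (p - x)) - dh x) \<bullet> (p - x) - k * t * (norm (p - x))\<^sup>2" for t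
  have der: "(\<phi> has_real_derivative \<phi>' t) (at t within {0..1})" if "t \<in> {0..1}" for t
    unfolding \<phi>_def \<phi>'_def using that
    by (auto intro!: derivative_eq_intros h_deriv_segment assms simp: inner_diff_left)
  have nonneg: "\<phi>' t \<ge> 0" if "t \<in> {0..1}" for t
  proof (cases "t = 0")
    case False
    have mem: "x + t *\<^sub>R (p - x) \<in> C" by (rule segment_in_C) (use assms that in auto)
    \<comment> \<open>Strong monotonicity compares points that differ by
      \<open>t *\<^sub>R (p - x)\<close>, so it gives the wanted inequality multiplied by
      \<open>t\<close>, which is then cancelled.\<close>
    have "t * (k * t * (norm (p - x))\<^sup>2) \<le> t * ((dh (x + t *\<^sub>R (p - x)) - dh x) \<bullet> (p - x))"
      using strong_mono[OF mem assms(2)] by (simp add: power_mult_distrib power2_eq_square ac_simps)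
    moreover have "t > 0" using False that by simp
    ultimately show ?thesis unfolding \<phi>'_def by simp
  qed (simp add: \<phi>'_def)
  have "\<exists>t\<in>{0..1}. \<phi> 1 - \<phi> 0 = \<phi>' t * (1 - 0)"
    by (rule mvt_very_simple) (use der in \<open>auto simp: has_field_derivative_def\<close>)
  then have "\<phi> 0 \<le> \<phi> 1" using nonneg by fastforce
  then show ?thesis unfolding \<phi>_def bregman_def by simp
qed

lemma bregman_nonneg: "p \<in> C \<Longrightarrow> x \<in> C \<Longrightarrow> 0 \<le> D p x"
  by (rule order_trans[OF _ bregman_lower]) (use k_pos in auto)

lemma bregman_self: "D x x = 0"
  by (simp add: bregman_def)

lemma cont_bregman: "continuous_on (C \<times> C) (\<lambda>z. D (fst z) (snd z))"
proof -
  have "continuous_on (C \<times> C) (\<lambda>z. h (fst z))" "continuous_on (C \<times> C) (\<lambda>z. h (snd z))"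
    "continuous_on (C \<times> C) (\<lambda>z. dh (snd z))"
    by (rule continuous_on_compose2[OF cont_h] continuous_on_compose2[OF cont_dh];
        auto intro!: continuous_intros)+
  then show ?thesis unfolding bregman_def by (intro continuous_intros)
qed

lemma cont_bregman_right: "p \<in> C \<Longrightarrow> continuous_on C (D p)"
  by (rule continuous_on_compose2[OF cont_bregman, of C "\<lambda>x. (p, x)", simplified])
    (auto intro!: continuous_intros)

lemma cont_bregman_left: "x \<in> C \<Longrightarrow> continuous_on C (\<lambda>p. D p x)"
  by (rule continuous_on_compose2[OF cont_bregman, of C "\<lambda>p. (p, x)", simplified])
    (auto intro!: continuous_intros)

text \<open>Compactness of \<open>C\<close> and continuity of the objective supply a minimizer;
  without one, the \<open>SOME\<close> in \<open>prox\<close> would carry no information.\<close>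

lemma prox_minimizes:
  assumes "x \<in> C"
  shows "prox C h dh x y \<in> C"
    and "z \<in> C \<Longrightarrow> y \<bullet> (x - prox C h dh x y) + D (prox C h dh x y) x \<le> y \<bullet> (x - z) + D z x"
proof -
  have "continuous_on C (\<lambda>z. y \<bullet> (x - z) + D z x)"
    by (intro continuous_intros cont_bregman_left assms)
  then have "\<exists>x'. x' \<in> C \<and> (\<forall>z\<in>C. y \<bullet> (x - x') + D x' x \<le> y \<bullet> (x - z) + D z x)"
    using continuous_attains_inf[OF compact_C, of "\<lambda>z. y \<bullet> (x - z) + D z x"] assms by blast
  from someI_ex[OF this]
  show "prox C h dh x y \<in> C"
    and "z \<in> C \<Longrightarrow> y \<bullet> (x - prox C h dh x y) + D (prox C h dh x y) x \<le> y \<bullet> (x - z) + D z x"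
    unfolding prox_def by auto
qed

text \<open>First-order condition: up to an additive constant \<phi> is the objective along the
  segment from the minimizer to \<open>z\<close>, so its one-sided derivative at 0 is
  nonnegative.\<close>

lemma prox_optimality:
  assumes "x \<in> C" "z \<in> C"
  shows "(dh (prox C h dh x y) - dh x - y) \<bullet> (z - prox C h dh x y) \<ge> 0"
proof -
  define P where "P = prox C h dh x y"
  define \<phi> where "\<phi> t = h (P + t *\<^sub>R (z - P)) - t * ((dh x + y) \<bullet> (z - P))" for t
  have P: "P \<in> C" unfolding P_def by (rule prox_minimizes(1)) fact
  have "\<phi> 0 \<le> \<phi> t" if "t \<in> {0..1}" for t
  proof -
    have "y \<bullet> (x - P) + D P x \<le> y \<bullet> (x - (P + t *\<^sub>R (z - P))) + D (P + t *\<^sub>R (z - P)) x"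
      unfolding P_def by (intro prox_minimizes segment_in_C assms) (use that in auto)
    then show ?thesis unfolding \<phi>_def bregman_def by (simp add: algebra_simps inner_simps)
  qed
  moreover have "(\<phi> has_real_derivative (dh P \<bullet> (z - P) - (dh x + y) \<bullet> (z - P))) (at 0 within {0..1})"
    unfolding \<phi>_def using h_deriv_segment[OF P assms(2), of 0]
    by (auto intro!: derivative_eq_intros)
  ultimately have "((\<lambda>t. (\<phi> t - \<phi> 0) / (t - 0)) \<longlongrightarrow> (dh P \<bullet> (z - P) - (dh x + y) \<bullet> (z - P))) (at 0 within {0..1})"
    by (simp add: has_field_derivative_iff)
  moreover have "eventually (\<lambda>t. 0 \<le> (\<phi> t - \<phi> 0) / (t - 0)) (at 0 within {0..1})"
    unfolding eventually_at_filter
    by (rule eventuallyI) (use \<open>\<And>t. t \<in> {0..1} \<Longrightarrow> \<phi> 0 \<le> \<phi> t\<close> in auto)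
  moreover have "at (0::real) within {0..1} \<noteq> bot"
    by (simp add: trivial_limit_within islimpt_Icc)
  ultimately have "0 \<le> dh P \<bullet> (z - P) - (dh x + y) \<bullet> (z - P)"
    by (intro tendsto_lowerbound)
  then show ?thesis unfolding P_def by (simp add: inner_diff_left inner_add_left algebra_simps)
qed

text \<open>Test optimality at \<open>z = x\<close> and compare with strong monotonicity. Applied to
  a step of length \<gamma>, it shows that both \<open>Y\<close> and the next \<open>X\<close> stay
  within order \<gamma> of the current iterate.\<close>

lemma prox_dist:
  assumes "x \<in> C"
  shows "k * norm (prox C h dh x y - x) \<le> norm y"
proof (cases "prox C h dh x y = x")
  case False
  define P where "P = prox C h dh x y"
  have P: "P \<in> C" unfolding P_def by (rule prox_minimizes(1)) fact
  have "k * (norm (P - x))\<^sup>2 \<le> (dh P - dh x) \<bullet> (P - x)" by (rule strong_mono[OF P assms])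
  also have "\<dots> \<le> y \<bullet> (P - x)"
    using prox_optimality[OF assms assms, of y] unfolding P_def[symmetric]
    by (simp add: inner_simps)
  also have "\<dots> \<le> norm y * norm (P - x)" by (rule norm_cauchy_schwarz)
  finally have "(k * norm (P - x)) * norm (P - x) \<le> norm y * norm (P - x)"
    by (simp add: power2_eq_square ac_simps)
  then show ?thesis unfolding P_def by (rule mult_right_le_imp_le) (use False in simp)
qed simp

text \<open>The plain mirror step gives the descent term \<open>r \<bullet> (X - p)\<close>.
  Replacing the new iterate \<open>X\<close> by \<open>Y\<close>, at which \<open>r\<close> is
  unbiased, costs \<open>r \<bullet> (Y - X)\<close>, and \<open>Y - X\<close> is itself of order
  \<gamma>, so the exchange is of second order.\<close>

lemma extragradient_step:
  fixes g r :: 'v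
  assumes "x \<in> C" "p \<in> C" "\<gamma> > 0"
  defines "Y \<equiv> prox C h dh x (- (\<gamma> *\<^sub>R g))" and "X \<equiv> prox C h dh x (- (\<gamma> *\<^sub>R r))"
  shows "D p X \<le> D p x - \<gamma> * (r \<bullet> (Y - p)) + 2 * \<gamma>\<^sup>2 / k * ((norm r)\<^sup>2 + (norm g)\<^sup>2)"
proof -
  have X: "X \<in> C" unfolding X_def by (rule prox_minimizes(1)) fact
  have three_point: "D p x = D p X + D X x + (dh X - dh x) \<bullet> (p - X)"
    unfolding bregman_def by (simp add: inner_simps)
  have "(dh X - dh x) \<bullet> (p - X) \<ge> \<gamma> * (r \<bullet> (X - p))"
    using prox_optimality[OF assms(1,2), of "- (\<gamma> *\<^sub>R r)"] unfolding X_def[symmetric]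
    by (simp add: inner_simps algebra_simps)
  \<comment> \<open>The term \<open>D X x\<close> of the three-point identity is nonnegative and is
    dropped.\<close>
  with three_point bregman_nonneg[OF X assms(1)]
  have 1: "D p X \<le> D p x - \<gamma> * (r \<bullet> (X - p))" by linarith
  have "k * norm (X - x) \<le> \<gamma> * norm r" "k * norm (Y - x) \<le> \<gamma> * norm g"
    unfolding X_def Y_def using prox_dist[OF assms(1), of "- (\<gamma> *\<^sub>R r)"]
      prox_dist[OF assms(1), of "- (\<gamma> *\<^sub>R g)"] assms(3) by auto
  moreover have "norm (Y - X) \<le> norm (X - x) + norm (Y - x)"
    using norm_triangle_ineq4[of "Y - x" "X - x"] by simp
  ultimately have "k * norm (Y - X) \<le> \<gamma> * (norm r + norm g)"
    using k_pos by (smt (verit, ccfv_SIG) distrib_left mult_left_mono)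
  then have "norm (Y - X) \<le> \<gamma> * (norm r + norm g) / k" using k_pos by (simp add: field_simps)
  then have "norm r * norm (Y - X) \<le> norm r * (\<gamma> * (norm r + norm g) / k)"
    by (rule mult_left_mono) simp
  moreover have "r \<bullet> (Y - X) \<le> norm r * norm (Y - X)" by (rule norm_cauchy_schwarz)
  ultimately have "r \<bullet> (Y - X) \<le> \<gamma> / k * (norm r * (norm r + norm g))"
    by (simp add: field_simps)
  also have "\<dots> \<le> \<gamma> / k * (2 * ((norm r)\<^sup>2 + (norm g)\<^sup>2))"
  proof (rule mult_left_mono)
    have "2 * (norm r * norm g) \<le> (norm r)\<^sup>2 + (norm g)\<^sup>2"
      using sum_squares_bound[of "norm r" "norm g"] by simp
    then show "norm r * (norm r + norm g) \<le> 2 * ((norm r)\<^sup>2 + (norm g)\<^sup>2)"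
      using zero_le_square[of "norm r"] zero_le_square[of "norm g"]
      unfolding power2_eq_square distrib_left by linarith
  qed (use k_pos assms(3) in simp)
  finally have "\<gamma> * (r \<bullet> (Y - X)) \<le> \<gamma> * (\<gamma> / k * (2 * ((norm r)\<^sup>2 + (norm g)\<^sup>2)))"
    by (rule mult_left_mono) (use assms(3) in simp)
  also have "\<dots> = 2 * \<gamma>\<^sup>2 / k * ((norm r)\<^sup>2 + (norm g)\<^sup>2)" by (simp add: power2_eq_square)
  finally show ?thesis using 1 by (simp add: inner_simps algebra_simps)
qed

end

section \<open>Almost supermartingales\<close>

text \<open>Monotone convergence: the total sum has finite integral, hence is finite almost
  everywhere. It serves for the number of sales, the squared displacements and the weighted
  gaps.\<close>

lemma (in prob_space) AE_summable_of_integral_sums_bounded: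
  fixes f :: "nat \<Rightarrow> 'a \<Rightarrow> real"
  assumes int: "\<And>n. integrable M (f n)" and nonneg: "\<And>n \<omega>. \<omega> \<in> space M \<Longrightarrow> f n \<omega> \<ge> 0"
    and bound: "\<And>N. (\<Sum>n<N. \<integral>\<omega>. f n \<omega> \<partial>M) \<le> c"
  shows "AE \<omega> in M. summable (\<lambda>n. f n \<omega>)"
proof -
  have [measurable]: "f n \<in> borel_measurable M" for n using int[of n] by simp
  have int_nonneg: "0 \<le> (\<integral>\<omega>. f n \<omega> \<partial>M)" for n
    by (rule integral_nonneg_AE) (use nonneg in auto)
  have summ: "summable (\<lambda>n. \<integral>\<omega>. f n \<omega> \<partial>M)"
    by (rule summableI_nonneg_bounded[OF int_nonneg bound])
  have "(\<integral>\<^sup>+\<omega>. (\<Sum>n. ennreal (f n \<omega>)) \<partial>M) = (\<Sum>n. \<integral>\<^sup>+\<omega>. ennreal (f n \<omega>) \<partial>M)"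
    by (rule nn_integral_suminf) simp
  also have "\<dots> = (\<Sum>n. ennreal (\<integral>\<omega>. f n \<omega> \<partial>M))"
    by (intro suminf_cong nn_integral_eq_integral int) (use nonneg in auto)
  also have "\<dots> = ennreal (\<Sum>n. \<integral>\<omega>. f n \<omega> \<partial>M)"
    by (rule suminf_ennreal2[OF int_nonneg summ])
  finally have "(\<integral>\<^sup>+\<omega>. (\<Sum>n. ennreal (f n \<omega>)) \<partial>M) \<noteq> \<infinity>" by simp
  then have "AE \<omega> in M. (\<Sum>n. ennreal (f n \<omega>)) \<noteq> \<infinity>"
    by (intro nn_integral_PInf_AE) auto
  then show ?thesis
  proof (rule AE_mp, intro AE_I2 impI)
    fix \<omega> assume "\<omega> \<in> space M" "(\<Sum>n. ennreal (f n \<omega>)) \<noteq> \<infinity>"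
    then show "summable (\<lambda>n. f n \<omega>)"
      by (intro summable_suminf_not_top) (use nonneg in auto)
  qed
qed

text \<open>Doob's upcrossing strategy: buy when the process drops below \<open>a\<close>,
  sell when it rises above \<open>b\<close>.\<close>

primrec holding :: "(nat \<Rightarrow> real) \<Rightarrow> real \<Rightarrow> real \<Rightarrow> nat \<Rightarrow> bool" where
  "holding z a b 0 = (z 0 < a)"
| "holding z a b (Suc n) = (if holding z a b n then z (Suc n) \<le> b else z (Suc n) < a)"

definition sells :: "(nat \<Rightarrow> real) \<Rightarrow> real \<Rightarrow> real \<Rightarrow> nat \<Rightarrow> bool" where
  "sells z a b n \<longleftrightarrow> holding z a b n \<and> \<not> holding z a b (Suc n)"

text \<open>Pathwise form of Doob's upcrossing inequality. The last term values the open position as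
  if it had been bought at \<open>a\<close>, an overestimate of the price paid; carrying it along
  makes the induction close.\<close>

lemma holding_gain:
  "(\<Sum>n<N. of_bool (holding z a b n) * (z (Suc n) - z n))
    \<ge> (b - a) * (\<Sum>n<N. of_bool (sells z a b n)) + (if holding z a b N then z N - a else 0)"
proof (induction N)
  case (Suc N)
  \<comment> \<open>One trading period in isolation: \<open>p\<close> and \<open>p'\<close> say
    whether the position is open before and after the price moves from \<open>y\<close> to
    \<open>y'\<close>, leaving four elementary cases.\<close>
  have step: "G + of_bool p * (y' - y) \<ge> (b - a) * (U + of_bool (p \<and> \<not> p')) + (if p' then y' - a else 0)"
    if "G \<ge> (b - a) * U + (if p then y - a else 0)" "p' = (if p then y' \<le> b else y' < a)"
    for G U y y' and p p' :: bool
    using that by (auto simp: algebra_simps split: if_splits)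
  show ?case
    using Suc.IH unfolding sum.lessThan_Suc sells_def by (rule step) simp
qed auto

text \<open>If sales stopped, a position open at the next visit below \<open>a\<close> would stay
  open for ever, contradicting a later visit above \<open>b\<close>.\<close>

lemma infinitely_many_sells:
  assumes "a < b" "\<exists>\<^sub>\<infinity>n. z n < a" "\<exists>\<^sub>\<infinity>n. z n > b"
  shows "\<exists>\<^sub>\<infinity>n. sells z a b n"
proof (rule ccontr)
  assume "\<not> ?thesis"
  then obtain N where N: "\<And>n. n \<ge> N \<Longrightarrow> \<not> sells z a b n"
    by (auto simp: INFM_nat_le)
  obtain n where n: "n \<ge> N" "z n < a" using assms(2) by (auto simp: INFM_nat_le)
  have holds: "holding z a b (n + i)" for i
  proof (induction i)
    case 0
    \<comment> \<open>Below \<open>a\<close> the position is open in any case: it is bought if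
      absent, and kept otherwise because \<open>a < b\<close>.\<close>
    show ?case using n(2) assms(1) by (cases n) auto
  next
    case (Suc i)
    then show ?case using N[of "n + i"] n(1) by (auto simp: sells_def)
  qed
  obtain m where m: "m \<ge> n" "z m > b" using assms(3) by (auto simp: INFM_nat_le)
  have "\<not> holding z a b m" using m(2) assms(1) by (cases m) auto
  then show False using holds[of "m - n"] m(1) by simp
qed

text \<open>Apply \<open>incr\<close> to the event that the strategy holds, which is known at time
  \<open>n\<close>. Expected profit is then at most the total error, while each sale earns at least
  \<open>b - a\<close>; so the expected number of sales is finite.\<close>

lemma (in prob_space) almost_supermartingale_finite_upcrossings:
  fixes Z :: "nat \<Rightarrow> 'a \<Rightarrow> real"
  assumes sub: "\<And>n. subalgebra M (F n)" and mono: "\<And>n. sets (F n) \<subseteq> sets (F (Suc n))"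
    and adapted: "\<And>n. Z n \<in> borel_measurable (F n)" and int: "\<And>n. integrable M (Z n)"
    and nonneg: "\<And>n \<omega>. \<omega> \<in> space M \<Longrightarrow> 0 \<le> Z n \<omega>"
    and incr: "\<And>n A. A \<in> sets (F n) \<Longrightarrow> (\<integral>\<omega>. indicator A \<omega> * (Z (Suc n) \<omega> - Z n \<omega>) \<partial>M) \<le> e n"
    and e: "\<And>n. e n \<ge> 0" "summable e" and ab: "0 \<le> a" "a < b"
  shows "AE \<omega> in M. \<not> ((\<exists>\<^sub>\<infinity>n. Z n \<omega> < a) \<and> (\<exists>\<^sub>\<infinity>n. Z n \<omega> > b))"
proof -
  define H where "H n = {\<omega> \<in> space M. holding (\<lambda>n. Z n \<omega>) a b n}" for n
  define T where "T n = {\<omega> \<in> space M. sells (\<lambda>n. Z n \<omega>) a b n}" for n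
  have space_F: "space (F n) = space M" for n using sub[of n] by (simp add: subalgebra_def)
  have level: "{\<omega> \<in> space M. Z n \<omega> < c} \<in> sets (F n)" "{\<omega> \<in> space M. Z n \<omega> \<le> c} \<in> sets (F n)" for n c
    using borel_measurable_less[OF adapted[of n] borel_measurable_const, of c]
      borel_measurable_le[OF adapted[of n] borel_measurable_const, of c]
    by (simp_all add: space_F)
  have H: "H n \<in> sets (F n)" for n
  proof (induction n)
    case 0
    show ?case unfolding H_def using level(1)[of 0 a] by simp
  next
    case (Suc n)
    then have H': "H n \<in> sets (F (Suc n))" using mono by blast
    have "H (Suc n) = (H n \<inter> {\<omega> \<in> space M. Z (Suc n) \<omega> \<le> b}) \<union>
        ({\<omega> \<in> space M. Z (Suc n) \<omega> < a} - H n)"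
      unfolding H_def by auto
    then show ?case using H' level by auto
  qed
  have H_M: "H n \<in> sets M" for n using H[of n] sub[of n] unfolding subalgebra_def by blast
  have "T n = H n - H (Suc n)" for n unfolding T_def H_def sells_def by auto
  then have T_M [measurable]: "T n \<in> sets M" for n using H_M by auto
  have [measurable]: "H n \<in> sets M" for n by (rule H_M)
  have int_gain: "integrable M (\<lambda>\<omega>. indicator (H n) \<omega> * (Z (Suc n) \<omega> - Z n \<omega>))" for n
    using integrable_mult_indicator[OF H_M[of n], of "\<lambda>\<omega>. Z (Suc n) \<omega> - Z n \<omega>"] int by simp
  have int_T: "integrable M (\<lambda>\<omega>. indicator (T n) \<omega> :: real)" for n
    by (rule integrable_real_indicator) (auto simp: emeasure_eq_measure)
  have bound: "(\<Sum>n<N. \<integral>\<omega>. indicator (T n) \<omega> \<partial>M) \<le> (a + suminf e) / (b - a)" for N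
  proof -
    \<comment> \<open>The term \<open>- a\<close> is the worst case at time \<open>N\<close>: an
      open position contributes \<open>Z N - a\<close>, and \<open>Z\<close> is nonnegative.\<close>
    have "(b - a) * (\<Sum>n<N. \<integral>\<omega>. indicator (T n) \<omega> \<partial>M) - a
        = (\<integral>\<omega>. (b - a) * (\<Sum>n<N. indicator (T n) \<omega>) - a \<partial>M)"
      using int_T by (simp add: prob_space)
    also have "\<dots> \<le> (\<integral>\<omega>. (\<Sum>n<N. indicator (H n) \<omega> * (Z (Suc n) \<omega> - Z n \<omega>)) \<partial>M)"
    proof (rule integral_mono)
      fix \<omega> assume \<omega>: "\<omega> \<in> space M"
      have "indicator (T n) \<omega> = (of_bool (sells (\<lambda>n. Z n \<omega>) a b n) :: real)"
        "indicator (H n) \<omega> = (of_bool (holding (\<lambda>n. Z n \<omega>) a b n) :: real)" for n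
        using \<omega> by (auto simp: T_def H_def indicator_def)
      then show "(b - a) * (\<Sum>n<N. indicator (T n) \<omega>) - a
          \<le> (\<Sum>n<N. indicator (H n) \<omega> * (Z (Suc n) \<omega> - Z n \<omega>))"
        using holding_gain[of b a "\<lambda>n. Z n \<omega>" N] nonneg[OF \<omega>, of N] ab(1)
        by (auto split: if_splits)
    next
      show "integrable M (\<lambda>\<omega>. \<Sum>n<N. indicator (H n) \<omega> * (Z (Suc n) \<omega> - Z n \<omega>))"
        by (rule Bochner_Integration.integrable_sum) (rule int_gain)
    qed (use int_T in simp)
    also have "\<dots> = (\<Sum>n<N. \<integral>\<omega>. indicator (H n) \<omega> * (Z (Suc n) \<omega> - Z n \<omega>) \<partial>M)"
      by (rule Bochner_Integration.integral_sum) (rule int_gain)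
    also have "\<dots> \<le> (\<Sum>n<N. e n)" by (intro sum_mono incr H)
    also have "\<dots> \<le> suminf e" by (rule sum_le_suminf) (use e in auto)
    finally show ?thesis using ab by (simp add: field_simps)
  qed
  have "AE \<omega> in M. summable (\<lambda>n. indicator (T n) \<omega> :: real)"
    by (rule AE_summable_of_integral_sums_bounded[OF int_T _ bound]) auto
  then show ?thesis
  proof (rule AE_mp, intro AE_I2 impI notI)
    fix \<omega> assume \<omega>: "\<omega> \<in> space M" and summ: "summable (\<lambda>n. indicator (T n) \<omega> :: real)"
      and "(\<exists>\<^sub>\<infinity>n. Z n \<omega> < a) \<and> (\<exists>\<^sub>\<infinity>n. Z n \<omega> > b)"
    then have inf: "\<exists>\<^sub>\<infinity>n. sells (\<lambda>n. Z n \<omega>) a b n" using infinitely_many_sells[OF ab(2), of "\<lambda>n. Z n \<omega>"] by blast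
    have "eventually (\<lambda>n. indicator (T n) \<omega> < (1::real)) sequentially"
      using summable_LIMSEQ_zero[OF summ] by (rule order_tendstoD) simp
    then obtain N where "\<And>n. n \<ge> N \<Longrightarrow> \<omega> \<notin> T n"
      by (auto simp: eventually_sequentially indicator_def split: if_splits)
    then show False using inf \<omega> by (auto simp: INFM_nat_le T_def)
  qed
qed

section \<open>The generated filtration and conditional expectations\<close>

lemma space_genF [simp]: "space (genF M X Y n m) = space M"
  unfolding genF_def by (rule space_measure_of) auto

lemma sets_genF:
  "sets (genF M X Y n m) = sigma_sets (space M)
     ((\<Union>i\<in>{1..n}. {X i -` A \<inter> space M | A. A \<in> sets borel}) \<union>
      (\<Union>j\<in>{1..m}. {Y j -` A \<inter> space M | A. A \<in> sets borel}))"
  unfolding genF_def by (rule sets_measure_of) auto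

lemma subalgebra_genF:
  assumes "\<And>n. X n \<in> borel_measurable M" "\<And>n. Y n \<in> borel_measurable M"
  shows "subalgebra M (genF M X Y n m)"
proof -
  have "sigma_sets (space M)
     ((\<Union>i\<in>{1..n}. {X i -` A \<inter> space M | A. A \<in> sets borel}) \<union>
      (\<Union>j\<in>{1..m}. {Y j -` A \<inter> space M | A. A \<in> sets borel})) \<subseteq> sets M"
    by (rule sets.sigma_sets_subset) (auto intro: measurable_sets[OF assms(1)] measurable_sets[OF assms(2)])
  then show ?thesis unfolding subalgebra_def sets_genF by simp
qed

lemma genF_mono:
  assumes "n \<le> n'" "m \<le> m'"
  shows "sets (genF M X Y n m) \<subseteq> sets (genF M X Y n' m')"
proof -
  have "{1..n} \<subseteq> {1..n'}" "{1..m} \<subseteq> {1..m'}" using assms by auto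
  then show ?thesis
    unfolding sets_genF by (intro sigma_sets_mono' Un_mono UN_mono subset_refl)
qed

lemma measurable_genF_left:
  assumes "1 \<le> i" "i \<le> n"
  shows "X i \<in> borel_measurable (genF M X Y n m)"
proof (rule measurableI)
  fix A :: "'b set" assume "A \<in> sets borel"
  moreover have "i \<in> {1..n}" using assms by simp
  ultimately show "X i -` A \<inter> space (genF M X Y n m) \<in> sets (genF M X Y n m)"
    unfolding sets_genF space_genF by (intro sigma_sets.Basic) blast
qed simp

lemma measurable_genF_right:
  assumes "1 \<le> i" "i \<le> m"
  shows "Y i \<in> borel_measurable (genF M X Y n m)"
proof (rule measurableI)
  fix A :: "'b set" assume "A \<in> sets borel"
  moreover have "i \<in> {1..m}" using assms by simp
  ultimately show "Y i -` A \<inter> space (genF M X Y n m) \<in> sets (genF M X Y n m)"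
    unfolding sets_genF space_genF by (intro sigma_sets.Basic) blast
qed simp

text \<open>The divergence and the field are known to be continuous only on the compact set, so the
  composition passes through \<open>restrict_space\<close>.\<close>

lemma borel_measurable_continuous_on_compose:
  fixes \<phi> :: "'v::topological_space \<Rightarrow> 'u::topological_space"
  assumes "continuous_on C \<phi>" "U \<in> borel_measurable N" "\<And>\<omega>. \<omega> \<in> space N \<Longrightarrow> U \<omega> \<in> C"
  shows "(\<lambda>\<omega>. \<phi> (U \<omega>)) \<in> borel_measurable N"
proof -
  have "U \<in> measurable N (restrict_space borel C)"
    by (rule measurable_restrict_space2) (use assms(2,3) in auto)
  from measurable_compose[OF this borel_measurable_continuous_on_restrict[OF assms(1)]]
  show ?thesis .
qed

lemma (in prob_space) integrable_continuous_on_compose: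
  fixes \<phi> :: "'v::topological_space \<Rightarrow> real"
  assumes "compact C" "continuous_on C \<phi>" "U \<in> borel_measurable M" "\<And>\<omega>. \<omega> \<in> space M \<Longrightarrow> U \<omega> \<in> C"
  shows "integrable M (\<lambda>\<omega>. \<phi> (U \<omega>))"
proof -
  have "bounded (\<phi> ` C)" by (intro compact_imp_bounded compact_continuous_image assms)
  then obtain B where "\<And>x. x \<in> C \<Longrightarrow> norm (\<phi> x) \<le> B" by (auto simp: bounded_iff)
  then show ?thesis
    by (intro integrable_const_bound[of _ B] AE_I2
        borel_measurable_continuous_on_compose[OF assms(2,3)]) (use assms(4) in auto)
qed

text \<open>\<open>cond_exp_is\<close> speaks about coordinates. Expanding the inner product in the
  basis leaves finitely many scalar terms whose weights \<phi> are \<open>F\<close>-measurable and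
  bounded, so each \<open>Z \<omega> \<bullet> b\<close> may be replaced by its conditional
  expectation under the integral.\<close>

lemma (in prob_space) integral_indicator_inner_cond_exp:
  fixes Z W V :: "'a \<Rightarrow> 'v::euclidean_space"
  assumes sub: "subalgebra M F" and ce: "cond_exp_is M F Z W"
    and V: "V \<in> borel_measurable F" "\<And>\<omega>. \<omega> \<in> space M \<Longrightarrow> norm (V \<omega>) \<le> R"
    and A: "A \<in> sets F" and W [measurable]: "W \<in> borel_measurable M"
  shows "integrable M (\<lambda>\<omega>. indicator A \<omega> * (Z \<omega> \<bullet> V \<omega>))"
    and "(\<integral>\<omega>. indicator A \<omega> * (Z \<omega> \<bullet> V \<omega>) \<partial>M) = (\<integral>\<omega>. indicator A \<omega> * (W \<omega> \<bullet> V \<omega>) \<partial>M)"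
proof -
  interpret S: finite_measure_subalgebra M F by unfold_locales (rule sub)
  have int_Z: "integrable M Z" using ce by (simp add: cond_exp_is_def)
  have [measurable]: "V \<in> borel_measurable M" by (rule measurable_from_subalg[OF sub V(1)])
  have [measurable]: "A \<in> sets M" using A sub unfolding subalgebra_def by blast
  have [measurable]: "Z \<in> borel_measurable M" using int_Z by simp
  define \<phi> where "\<phi> b \<omega> = indicator A \<omega> * (V \<omega> \<bullet> b)" for b \<omega>
  have \<phi>: "\<phi> b \<in> borel_measurable F" for b
    unfolding \<phi>_def using V(1) A by measurable
  have int: "integrable M (\<lambda>\<omega>. \<phi> b \<omega> * (Z \<omega> \<bullet> b))" if "b \<in> Basis" for b
  proof (rule Bochner_Integration.integrable_bound)
    show "integrable M (\<lambda>\<omega>. R * norm (Z \<omega>))" using int_Z by simp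
    show "(\<lambda>\<omega>. \<phi> b \<omega> * (Z \<omega> \<bullet> b)) \<in> borel_measurable M" unfolding \<phi>_def by measurable
    show "AE \<omega> in M. norm (\<phi> b \<omega> * (Z \<omega> \<bullet> b)) \<le> norm (R * norm (Z \<omega>))"
    proof (rule AE_I2)
      fix \<omega> assume \<omega>: "\<omega> \<in> space M"
      have "\<bar>V \<omega> \<bullet> b\<bar> \<le> R" using Basis_le_norm[OF that] V(2)[OF \<omega>] by (rule order_trans)
      then have "\<bar>\<phi> b \<omega>\<bar> \<le> R" unfolding \<phi>_def by (auto simp: indicator_def abs_mult)
      moreover have "\<bar>Z \<omega> \<bullet> b\<bar> \<le> norm (Z \<omega>)" by (rule Basis_le_norm[OF that])
      ultimately have "\<bar>\<phi> b \<omega>\<bar> * \<bar>Z \<omega> \<bullet> b\<bar> \<le> R * norm (Z \<omega>)" by (intro mult_mono) auto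
      also have "\<dots> \<le> \<bar>R * norm (Z \<omega>)\<bar>" by simp
      finally show "norm (\<phi> b \<omega> * (Z \<omega> \<bullet> b)) \<le> norm (R * norm (Z \<omega>))" by (simp add: abs_mult)
    qed
  qed
  have expand: "indicator A \<omega> * (z \<bullet> V \<omega>) = (\<Sum>b\<in>Basis. \<phi> b \<omega> * (z \<bullet> b))" for z \<omega>
    unfolding euclidean_inner[of z "V \<omega>"] \<phi>_def by (simp add: sum_distrib_left ac_simps)
  have ce_b: "AE \<omega> in M. \<phi> b \<omega> * real_cond_exp M F (\<lambda>\<omega>. Z \<omega> \<bullet> b) \<omega> = \<phi> b \<omega> * (W \<omega> \<bullet> b)" if "b \<in> Basis" for b
  proof -
    have "AE \<omega> in M. real_cond_exp M F (\<lambda>\<omega>. Z \<omega> \<bullet> b) \<omega> = W \<omega> \<bullet> b"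
      using ce that by (auto simp: cond_exp_is_def)
    then show ?thesis by eventually_elim simp
  qed
  show "integrable M (\<lambda>\<omega>. indicator A \<omega> * (Z \<omega> \<bullet> V \<omega>))"
    unfolding expand by (rule Bochner_Integration.integrable_sum) (rule int)
  have intC: "integrable M (\<lambda>\<omega>. \<phi> b \<omega> * real_cond_exp M F (\<lambda>\<omega>. Z \<omega> \<bullet> b) \<omega>)"
    and eqC: "(\<integral>\<omega>. \<phi> b \<omega> * real_cond_exp M F (\<lambda>\<omega>. Z \<omega> \<bullet> b) \<omega> \<partial>M) = (\<integral>\<omega>. \<phi> b \<omega> * (Z \<omega> \<bullet> b) \<partial>M)"
    if "b \<in> Basis" for b
    using S.real_cond_exp_intg[OF int[OF that] \<phi>] by simp_all
  have "(\<integral>\<omega>. indicator A \<omega> * (Z \<omega> \<bullet> V \<omega>) \<partial>M) = (\<Sum>b\<in>Basis. \<integral>\<omega>. \<phi> b \<omega> * (Z \<omega> \<bullet> b) \<partial>M)"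
    unfolding expand by (rule Bochner_Integration.integral_sum) (rule int)
  also have "\<dots> = (\<Sum>b\<in>Basis. \<integral>\<omega>. \<phi> b \<omega> * real_cond_exp M F (\<lambda>\<omega>. Z \<omega> \<bullet> b) \<omega> \<partial>M)"
    by (intro sum.cong refl eqC[symmetric])
  also have "\<dots> = (\<integral>\<omega>. (\<Sum>b\<in>Basis. \<phi> b \<omega> * real_cond_exp M F (\<lambda>\<omega>. Z \<omega> \<bullet> b) \<omega>) \<partial>M)"
    by (rule Bochner_Integration.integral_sum[symmetric]) (rule intC)
  also have "\<dots> = (\<integral>\<omega>. indicator A \<omega> * (W \<omega> \<bullet> V \<omega>) \<partial>M)"
    unfolding expand
  proof (rule integral_cong_AE)
    have "AE \<omega> in M. \<forall>b\<in>Basis. \<phi> b \<omega> * real_cond_exp M F (\<lambda>\<omega>. Z \<omega> \<bullet> b) \<omega> = \<phi> b \<omega> * (W \<omega> \<bullet> b)"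
      by (rule AE_finite_allI[OF finite_Basis ce_b])
    then show "AE \<omega> in M. (\<Sum>b\<in>Basis. \<phi> b \<omega> * real_cond_exp M F (\<lambda>\<omega>. Z \<omega> \<bullet> b) \<omega>) = (\<Sum>b\<in>Basis. \<phi> b \<omega> * (W \<omega> \<bullet> b))"
      by (rule AE_mp) (intro AE_I2 impI sum.cong refl, blast)
    show "(\<lambda>\<omega>. \<Sum>b\<in>Basis. \<phi> b \<omega> * real_cond_exp M F (\<lambda>\<omega>. Z \<omega> \<bullet> b) \<omega>) \<in> borel_measurable M"
      by (intro borel_measurable_sum borel_measurable_integrable intC)
    show "(\<lambda>\<omega>. \<Sum>b\<in>Basis. \<phi> b \<omega> * (W \<omega> \<bullet> b)) \<in> borel_measurable M"
      unfolding \<phi>_def by measurable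
  qed
  finally show "(\<integral>\<omega>. indicator A \<omega> * (Z \<omega> \<bullet> V \<omega>) \<partial>M) = (\<integral>\<omega>. indicator A \<omega> * (W \<omega> \<bullet> V \<omega>) \<partial>M)" .
qed

section \<open>Optimistic mirror descent\<close>

lemma integral_indicator_le:
  assumes "A \<in> sets M" "integrable M f" "\<And>\<omega>. f \<omega> \<ge> (0::real)"
  shows "(\<integral>\<omega>. indicator A \<omega> * f \<omega> \<partial>M) \<le> (\<integral>\<omega>. f \<omega> \<partial>M)"
  by (rule integral_mono) (use assms integrable_mult_indicator[of A M f] in \<open>auto simp: indicator_def\<close>)

text \<open>The conditional second-moment bounds enter in integrated form, through \<open>c\<close>.
  Time starts at 1 and nothing places \<open>X 0\<close> or \<open>Y 0\<close> in \<open>C\<close>,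
  hence the guards \<open>n \<ge> 1\<close> and the shifts to \<open>n + 1\<close>.\<close>

locale extragradient = bregman_geometry C h dh k + prob_space M
  for C :: "'v::euclidean_space set" and h dh k and M :: "'w measure" +
  fixes X Y G R :: "nat \<Rightarrow> 'w \<Rightarrow> 'v" and \<gamma> :: "nat \<Rightarrow> real" and g :: "'v \<Rightarrow> 'v" and c :: real
  assumes X_M [measurable]: "X n \<in> borel_measurable M" and Y_M [measurable]: "Y n \<in> borel_measurable M"
    and X_1: "\<omega> \<in> space M \<Longrightarrow> X 1 \<omega> \<in> C"
    and Y_step: "n \<ge> 1 \<Longrightarrow> \<omega> \<in> space M \<Longrightarrow> Y n \<omega> = prox C h dh (X n \<omega>) (- (\<gamma> n *\<^sub>R G n \<omega>))"
    and X_step: "n \<ge> 1 \<Longrightarrow> \<omega> \<in> space M \<Longrightarrow> X (n + 1) \<omega> = prox C h dh (X n \<omega>) (- (\<gamma> n *\<^sub>R R n \<omega>))"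
    and cont_g: "continuous_on C g"
    and unbiased: "n \<ge> 1 \<Longrightarrow> cond_exp_is M (genF M X Y n n) (R n) (\<lambda>\<omega>. g (Y n \<omega>))"
    and int_G: "n \<ge> 1 \<Longrightarrow> integrable M (\<lambda>\<omega>. (norm (G n \<omega>))\<^sup>2)"
    and int_R: "n \<ge> 1 \<Longrightarrow> integrable M (\<lambda>\<omega>. (norm (R n \<omega>))\<^sup>2)"
    and bound_G: "n \<ge> 1 \<Longrightarrow> (\<integral>\<omega>. (norm (G n \<omega>))\<^sup>2 \<partial>M) \<le> c"
    and bound_R: "n \<ge> 1 \<Longrightarrow> (\<integral>\<omega>. (norm (R n \<omega>))\<^sup>2 \<partial>M) \<le> c"
    and step_pos: "n \<ge> 1 \<Longrightarrow> \<gamma> n > 0"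
    and step_sq: "summable (\<lambda>n. (\<gamma> (n + 1))\<^sup>2)"
begin

lemma X_in_C: "n \<ge> 1 \<Longrightarrow> \<omega> \<in> space M \<Longrightarrow> X n \<omega> \<in> C"
proof (induction n rule: dec_induct)
  case base
  then show ?case by (rule X_1)
next
  case (step n)
  then show ?case using X_step[of n \<omega>] prox_minimizes(1) by simp
qed

lemma Y_in_C: "n \<ge> 1 \<Longrightarrow> \<omega> \<in> space M \<Longrightarrow> Y n \<omega> \<in> C"
  using Y_step X_in_C prox_minimizes(1) by simp

lemma c_nonneg: "c \<ge> 0"
  by (rule order_trans[OF _ bound_G[OF order_refl]]) simp

lemma sub_F: "subalgebra M (genF M X Y n m)"
  by (intro subalgebra_genF X_M Y_M)

lemma sets_F_imp_sets_M: "A \<in> sets (genF M X Y n m) \<Longrightarrow> A \<in> sets M"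
  using sub_F[of n m] unfolding subalgebra_def by blast

lemma integrable_X: "continuous_on C \<phi> \<Longrightarrow> n \<ge> 1 \<Longrightarrow> integrable M (\<lambda>\<omega>. \<phi> (X n \<omega>) :: real)"
  by (rule integrable_continuous_on_compose[OF compact_C _ X_M X_in_C])

lemma integrable_Y: "continuous_on C \<phi> \<Longrightarrow> n \<ge> 1 \<Longrightarrow> integrable M (\<lambda>\<omega>. \<phi> (Y n \<omega>) :: real)"
  by (rule integrable_continuous_on_compose[OF compact_C _ Y_M Y_in_C])

lemma cont_g_inner: "continuous_on C (\<lambda>y. g y \<bullet> (y - q))"
  by (intro continuous_intros cont_g)

lemma oracle_unbiased:
  assumes n: "n \<ge> 1" and q: "q \<in> C" and A: "A \<in> sets (genF M X Y n n)"
  shows "integrable M (\<lambda>\<omega>. indicator A \<omega> * (R n \<omega> \<bullet> (Y n \<omega> - q)))"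
    and "(\<integral>\<omega>. indicator A \<omega> * (R n \<omega> \<bullet> (Y n \<omega> - q)) \<partial>M) = (\<integral>\<omega>. indicator A \<omega> * (g (Y n \<omega>) \<bullet> (Y n \<omega> - q)) \<partial>M)"
proof -
  obtain B where B: "\<And>x y. x \<in> C \<Longrightarrow> y \<in> C \<Longrightarrow> norm (x - y) \<le> B" using bounded_C by blast
  have 1: "(\<lambda>\<omega>. Y n \<omega> - q) \<in> borel_measurable (genF M X Y n n)"
    by (intro borel_measurable_diff measurable_genF_right borel_measurable_const n order_refl)
  have 2: "norm (Y n \<omega> - q) \<le> B" if "\<omega> \<in> space M" for \<omega> by (rule B[OF Y_in_C[OF n that] q])
  have 3: "(\<lambda>\<omega>. g (Y n \<omega>)) \<in> borel_measurable M"
    by (rule borel_measurable_continuous_on_compose[OF cont_g Y_M Y_in_C[OF n]])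
  show "integrable M (\<lambda>\<omega>. indicator A \<omega> * (R n \<omega> \<bullet> (Y n \<omega> - q)))"
    and "(\<integral>\<omega>. indicator A \<omega> * (R n \<omega> \<bullet> (Y n \<omega> - q)) \<partial>M) = (\<integral>\<omega>. indicator A \<omega> * (g (Y n \<omega>) \<bullet> (Y n \<omega> - q)) \<partial>M)"
    by (rule integral_indicator_inner_cond_exp[OF sub_F unbiased[OF n] 1 2 A 3]; assumption)+
qed

text \<open>Both \<open>A\<close> and \<open>Y n\<close> belong to the past against which
  \<open>R n\<close> is unbiased, so integrating the one-step inequality over \<open>A\<close>
  replaces \<open>R n\<close> by the field. The constant is the factor 2 of the one-step error times
  the bound \<open>2 * c\<close> for the two second moments.\<close>

lemma expected_step:
  assumes n: "n \<ge> 1" and q: "q \<in> C" and A: "A \<in> sets (genF M X Y n n)"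
  shows "(\<integral>\<omega>. indicator A \<omega> * (D q (X (n + 1) \<omega>) - D q (X n \<omega>)) \<partial>M)
    \<le> - \<gamma> n * (\<integral>\<omega>. indicator A \<omega> * (g (Y n \<omega>) \<bullet> (Y n \<omega> - q)) \<partial>M) + 4 * c / k * (\<gamma> n)\<^sup>2"
proof -
  have A_M: "A \<in> sets M" by (rule sets_F_imp_sets_M[OF A])
  have int_ind: "integrable M (\<lambda>\<omega>. indicator A \<omega> * f \<omega>)" if "integrable M f" for f :: "'w \<Rightarrow> real"
    using integrable_mult_indicator[OF A_M that] by simp
  define r where "r \<omega> = indicator A \<omega> * (R n \<omega> \<bullet> (Y n \<omega> - q))" for \<omega>
  define s where "s \<omega> = indicator A \<omega> * ((norm (R n \<omega>))\<^sup>2 + (norm (G n \<omega>))\<^sup>2)" for \<omega>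
  have r: "integrable M r" unfolding r_def by (rule oracle_unbiased(1)[OF n q A])
  have rg: "integrable M (\<lambda>\<omega>. (norm (R n \<omega>))\<^sup>2 + (norm (G n \<omega>))\<^sup>2)"
    by (intro Bochner_Integration.integrable_add int_R int_G n)
  have s: "integrable M s" unfolding s_def by (rule int_ind[OF rg])
  have "(\<integral>\<omega>. s \<omega> \<partial>M) \<le> (\<integral>\<omega>. (norm (R n \<omega>))\<^sup>2 + (norm (G n \<omega>))\<^sup>2 \<partial>M)"
    unfolding s_def by (rule integral_indicator_le[OF A_M rg]) simp
  also have "\<dots> = (\<integral>\<omega>. (norm (R n \<omega>))\<^sup>2 \<partial>M) + (\<integral>\<omega>. (norm (G n \<omega>))\<^sup>2 \<partial>M)"
    by (rule Bochner_Integration.integral_add[OF int_R[OF n] int_G[OF n]])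
  also have "\<dots> \<le> 2 * c" using bound_G[OF n] bound_R[OF n] by simp
  finally have s_le: "(\<integral>\<omega>. s \<omega> \<partial>M) \<le> 2 * c" .
  have "(\<integral>\<omega>. indicator A \<omega> * (D q (X (n + 1) \<omega>) - D q (X n \<omega>)) \<partial>M)
      \<le> (\<integral>\<omega>. - \<gamma> n * r \<omega> + 2 * (\<gamma> n)\<^sup>2 / k * s \<omega> \<partial>M)"
  proof (rule integral_mono)
    show "integrable M (\<lambda>\<omega>. indicator A \<omega> * (D q (X (n + 1) \<omega>) - D q (X n \<omega>)))"
      by (intro int_ind Bochner_Integration.integrable_diff integrable_X cont_bregman_right q) (use n in auto)
    show "integrable M (\<lambda>\<omega>. - \<gamma> n * r \<omega> + 2 * (\<gamma> n)\<^sup>2 / k * s \<omega>)" using r s by simp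
    fix \<omega> assume \<omega>: "\<omega> \<in> space M"
    show "indicator A \<omega> * (D q (X (n + 1) \<omega>) - D q (X n \<omega>)) \<le> - \<gamma> n * r \<omega> + 2 * (\<gamma> n)\<^sup>2 / k * s \<omega>"
      using extragradient_step[OF X_in_C[OF n \<omega>] q step_pos[OF n], of "R n \<omega>" "G n \<omega>"]
      unfolding Y_step[OF n \<omega>, symmetric] X_step[OF n \<omega>, symmetric] r_def s_def
      by (cases "\<omega> \<in> A") auto
  qed
  also have "\<dots> = - \<gamma> n * (\<integral>\<omega>. r \<omega> \<partial>M) + 2 * (\<gamma> n)\<^sup>2 / k * (\<integral>\<omega>. s \<omega> \<partial>M)"
    using r s by simp
  also have "2 * (\<gamma> n)\<^sup>2 / k * (\<integral>\<omega>. s \<omega> \<partial>M) \<le> 2 * (\<gamma> n)\<^sup>2 / k * (2 * c)"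
    by (rule mult_left_mono[OF s_le]) (use k_pos in simp)
  also have "\<dots> = 4 * c / k * (\<gamma> n)\<^sup>2" by simp
  finally show ?thesis unfolding r_def oracle_unbiased(2)[OF n q A] by simp
qed

lemma displacement:
  assumes "n \<ge> 1" "\<omega> \<in> space M"
  shows "(norm (Y n \<omega> - X n \<omega>))\<^sup>2 \<le> (\<gamma> n)\<^sup>2 / k\<^sup>2 * (norm (G n \<omega>))\<^sup>2"
proof -
  have "k * norm (Y n \<omega> - X n \<omega>) \<le> \<gamma> n * norm (G n \<omega>)"
    using prox_dist[OF X_in_C[OF assms], of "- (\<gamma> n *\<^sub>R G n \<omega>)"] step_pos[OF assms(1)]
    unfolding Y_step[OF assms, symmetric] by simp
  then have "norm (Y n \<omega> - X n \<omega>) \<le> \<gamma> n * norm (G n \<omega>) / k"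
    using k_pos by (simp add: field_simps)
  then have "(norm (Y n \<omega> - X n \<omega>))\<^sup>2 \<le> (\<gamma> n * norm (G n \<omega>) / k)\<^sup>2"
    by (rule power_mono) simp
  then show ?thesis by (simp add: power_mult_distrib power_divide)
qed

lemma step_sq_le: "n \<ge> 1 \<Longrightarrow> (\<gamma> n)\<^sup>2 \<le> (\<Sum>n. (\<gamma> (n + 1))\<^sup>2)"
  using sum_le_suminf[OF step_sq, of "{n - 1}"] by simp

text \<open>A uniform bound on the step sizes, from (\<gamma> - 1/2)^2 \<ge> 0; it reduces
  third-order errors to multiples of \<gamma>^2.\<close>

lemma step_le: "n \<ge> 1 \<Longrightarrow> \<gamma> n \<le> 1 + (\<Sum>n. (\<gamma> (n + 1))\<^sup>2)"
proof -
  assume "n \<ge> 1"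
  moreover have "\<gamma> n \<le> 1 + (\<gamma> n)\<^sup>2" using zero_le_power2[of "\<gamma> n - 1/2"] by (simp add: power2_eq_square algebra_simps)
  ultimately show ?thesis using step_sq_le by fastforce
qed

text \<open>Drift matters only while \<open>D q (X n)\<close> is below \<open>c0\<close>. There, if
  \<open>Y n\<close> is close to \<open>X n\<close>, then \<open>D q (Y n)\<close> is below
  \<open>2 * c0\<close> and the local inequality applies; otherwise the loss is at most
  \<open>B\<close>, and the displacement bound pays for it.\<close>

lemma truncated_divergence_step:
  assumes q: "q \<in> C" and c0: "c0 > 0" and local: "\<And>y. y \<in> C \<Longrightarrow> D q y \<le> 2 * c0 \<Longrightarrow> g y \<bullet> (y - q) \<ge> 0"
  shows "\<exists>L\<ge>0. \<forall>n\<ge>1. \<forall>A\<in>sets (genF M X Y n (n - 1)).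
    (\<integral>\<omega>. indicator A \<omega> * (min (D q (X (n + 1) \<omega>)) c0 - min (D q (X n \<omega>)) c0) \<partial>M) \<le> L * (\<gamma> n)\<^sup>2"
proof -
  \<comment> \<open>Uniform continuity with tolerance \<open>c0\<close> yields the margin: a move
    shorter than \<eta> cannot carry \<open>D q\<close> from below \<open>c0\<close> to
    \<open>2 * c0\<close>.\<close>
  obtain \<eta> where \<eta>: "\<eta> > 0" "\<And>x y. x \<in> C \<Longrightarrow> y \<in> C \<Longrightarrow> norm (y - x) < \<eta> \<Longrightarrow> \<bar>D q y - D q x\<bar> < c0"
    using compact_uniformly_continuous[OF cont_bregman_right[OF q] compact_C] c0
    unfolding uniformly_continuous_on_def dist_norm by (metis real_norm_def)
  have "bounded ((\<lambda>y. g y \<bullet> (y - q)) ` C)"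
    by (intro compact_imp_bounded compact_continuous_image cont_g_inner compact_C)
  then obtain B where B: "B > 0" "\<And>y. y \<in> C \<Longrightarrow> \<bar>g y \<bullet> (y - q)\<bar> \<le> B"
    unfolding bounded_pos by auto
  have local': "g y \<bullet> (y - q) \<ge> - (B / \<eta>\<^sup>2) * (norm (y - x))\<^sup>2"
    if "x \<in> C" "y \<in> C" "D q x < c0" for x y
  proof (cases "norm (y - x) < \<eta>")
    case True
    then have "g y \<bullet> (y - q) \<ge> 0" using \<eta>(2)[OF that(1,2)] that(3) by (intro local that(2)) linarith
    moreover have "(B / \<eta>\<^sup>2) * (norm (y - x))\<^sup>2 \<ge> 0" using B(1) by simp
    ultimately show ?thesis by linarith
  next
    case False
    then have "\<eta>\<^sup>2 \<le> (norm (y - x))\<^sup>2" using \<eta>(1) by (intro power_mono) auto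
    then have "B / \<eta>\<^sup>2 * \<eta>\<^sup>2 \<le> B / \<eta>\<^sup>2 * (norm (y - x))\<^sup>2" using B(1) by (intro mult_left_mono) auto
    then show ?thesis using B(2)[OF that(2)] \<eta>(1) by simp
  qed
  define \<Gamma> where "\<Gamma> = 1 + (\<Sum>n. (\<gamma> (n + 1))\<^sup>2)"
  define b where "b = B / \<eta>\<^sup>2 / k\<^sup>2"
  have b: "b \<ge> 0" unfolding b_def using B(1) by simp
  have \<Gamma>: "\<Gamma> \<ge> 0" unfolding \<Gamma>_def using suminf_nonneg[OF step_sq] by simp
  define L where "L = \<Gamma> * b * c + 4 * c / k"
  have "(\<integral>\<omega>. indicator A \<omega> * (min (D q (X (n + 1) \<omega>)) c0 - min (D q (X n \<omega>)) c0) \<partial>M) \<le> L * (\<gamma> n)\<^sup>2"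
    if n: "n \<ge> 1" and A: "A \<in> sets (genF M X Y n (n - 1))" for n A
  proof -
    \<comment> \<open>Outside this event the truncated process sits at its cap and cannot rise.
      Inside it the start is below the cap, so truncation affects only the end value and can only
      lower the increment.\<close>
    define A' where "A' = A \<inter> {\<omega> \<in> space M. D q (X n \<omega>) < c0}"
    have "(\<lambda>\<omega>. D q (X n \<omega>)) \<in> borel_measurable (genF M X Y n (n - 1))"
      by (rule borel_measurable_continuous_on_compose[OF cont_bregman_right[OF q] measurable_genF_left])
        (use n X_in_C in auto)
    from borel_measurable_less[OF this borel_measurable_const]
    have "A' \<in> sets (genF M X Y n (n - 1))" unfolding A'_def using A by auto
    then have A': "A' \<in> sets (genF M X Y n n)" using genF_mono[of n n "n - 1" n M X Y] by auto
    have A_M: "A \<in> sets M" and A'_M: "A' \<in> sets M" using A A' sets_F_imp_sets_M by blast+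
    have intA: "integrable M (\<lambda>\<omega>. indicator A \<omega> * f \<omega>)" if "integrable M f" for f :: "'w \<Rightarrow> real"
      using integrable_mult_indicator[OF A_M that] by simp
    have intA': "integrable M (\<lambda>\<omega>. indicator A' \<omega> * f \<omega>)" if "integrable M f" for f :: "'w \<Rightarrow> real"
      using integrable_mult_indicator[OF A'_M that] by simp
    have cont_min: "continuous_on C (\<lambda>x. min (D q x) c0)"
      by (intro continuous_intros cont_bregman_right q)
    have "(\<integral>\<omega>. indicator A \<omega> * (min (D q (X (n + 1) \<omega>)) c0 - min (D q (X n \<omega>)) c0) \<partial>M)
        \<le> (\<integral>\<omega>. indicator A' \<omega> * (D q (X (n + 1) \<omega>) - D q (X n \<omega>)) \<partial>M)"
    proof (rule integral_mono)
      show "integrable M (\<lambda>\<omega>. indicator A \<omega> * (min (D q (X (n + 1) \<omega>)) c0 - min (D q (X n \<omega>)) c0))"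
        by (intro intA Bochner_Integration.integrable_diff integrable_X[OF cont_min]) (use n in auto)
      show "integrable M (\<lambda>\<omega>. indicator A' \<omega> * (D q (X (n + 1) \<omega>) - D q (X n \<omega>)))"
        by (intro intA' Bochner_Integration.integrable_diff integrable_X cont_bregman_right q) (use n in auto)
    qed (auto simp: A'_def indicator_def)
    also have "\<dots> \<le> \<gamma> n * - (\<integral>\<omega>. indicator A' \<omega> * (g (Y n \<omega>) \<bullet> (Y n \<omega> - q)) \<partial>M) + 4 * c / k * (\<gamma> n)\<^sup>2"
      using expected_step[OF n q A'] by simp
    also have "- (\<integral>\<omega>. indicator A' \<omega> * (g (Y n \<omega>) \<bullet> (Y n \<omega> - q)) \<partial>M)
        = (\<integral>\<omega>. - (indicator A' \<omega> * (g (Y n \<omega>) \<bullet> (Y n \<omega> - q))) \<partial>M)" by simp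
    also have "\<dots> \<le> (\<integral>\<omega>. b * (\<gamma> n)\<^sup>2 * (norm (G n \<omega>))\<^sup>2 \<partial>M)"
    proof (rule integral_mono)
      show "integrable M (\<lambda>\<omega>. - (indicator A' \<omega> * (g (Y n \<omega>) \<bullet> (Y n \<omega> - q))))"
        by (intro Bochner_Integration.integrable_minus intA' integrable_Y[OF cont_g_inner] n)
      show "integrable M (\<lambda>\<omega>. b * (\<gamma> n)\<^sup>2 * (norm (G n \<omega>))\<^sup>2)" using int_G[OF n] by simp
      fix \<omega> assume \<omega>: "\<omega> \<in> space M"
      show "- (indicator A' \<omega> * (g (Y n \<omega>) \<bullet> (Y n \<omega> - q))) \<le> b * (\<gamma> n)\<^sup>2 * (norm (G n \<omega>))\<^sup>2"
      proof (cases "\<omega> \<in> A'")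
        case True
        then have "- (g (Y n \<omega>) \<bullet> (Y n \<omega> - q)) \<le> B / \<eta>\<^sup>2 * (norm (Y n \<omega> - X n \<omega>))\<^sup>2"
          using local'[OF X_in_C[OF n \<omega>] Y_in_C[OF n \<omega>]] by (simp add: A'_def)
        also have "\<dots> \<le> B / \<eta>\<^sup>2 * ((\<gamma> n)\<^sup>2 / k\<^sup>2 * (norm (G n \<omega>))\<^sup>2)"
          by (rule mult_left_mono[OF displacement[OF n \<omega>]]) (use B(1) in simp)
        finally show ?thesis using True by (simp add: b_def)
      qed (use b in simp)
    qed
    also have "\<dots> = b * (\<gamma> n)\<^sup>2 * (\<integral>\<omega>. (norm (G n \<omega>))\<^sup>2 \<partial>M)" by simp
    also have "\<dots> \<le> b * (\<gamma> n)\<^sup>2 * c" by (rule mult_left_mono[OF bound_G[OF n]]) (use b in simp)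
    finally have "(\<integral>\<omega>. indicator A \<omega> * (min (D q (X (n + 1) \<omega>)) c0 - min (D q (X n \<omega>)) c0) \<partial>M)
        \<le> \<gamma> n * (b * (\<gamma> n)\<^sup>2 * c) + 4 * c / k * (\<gamma> n)\<^sup>2"
      using step_pos[OF n] by (simp add: mult_left_mono)
    also have "\<gamma> n * (b * (\<gamma> n)\<^sup>2 * c) \<le> \<Gamma> * (b * (\<gamma> n)\<^sup>2 * c)"
      by (rule mult_right_mono) (use step_le[OF n] b c_nonneg in \<open>auto simp: \<Gamma>_def\<close>)
    finally show ?thesis unfolding L_def by (simp add: algebra_simps)
  qed
  moreover have "L \<ge> 0" unfolding L_def using \<Gamma> b c_nonneg k_pos by simp
  ultimately show ?thesis by blast
qed

lemma AE_finite_upcrossings: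
  assumes q: "q \<in> C" and c0: "c0 > 0" and local: "\<And>y. y \<in> C \<Longrightarrow> D q y \<le> 2 * c0 \<Longrightarrow> g y \<bullet> (y - q) \<ge> 0"
    and ab: "0 \<le> a" "a < b"
  shows "AE \<omega> in M. \<not> ((\<exists>\<^sub>\<infinity>n. min (D q (X (n + 1) \<omega>)) c0 < a) \<and> (\<exists>\<^sub>\<infinity>n. min (D q (X (n + 1) \<omega>)) c0 > b))"
proof -
  obtain L where L: "L \<ge> 0" "\<And>n A. n \<ge> 1 \<Longrightarrow> A \<in> sets (genF M X Y n (n - 1)) \<Longrightarrow>
      (\<integral>\<omega>. indicator A \<omega> * (min (D q (X (n + 1) \<omega>)) c0 - min (D q (X n \<omega>)) c0) \<partial>M) \<le> L * (\<gamma> n)\<^sup>2"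
    using truncated_divergence_step[OF q c0 local] by blast
  have cont_min: "continuous_on C (\<lambda>x. min (D q x) c0)"
    by (intro continuous_intros cont_bregman_right q)
  show ?thesis
  \<comment> \<open>The filtration is taken at the moment when \<open>X (n + 1)\<close> is known and
    \<open>Y (n + 1)\<close> is not.\<close>
  proof (rule almost_supermartingale_finite_upcrossings[where
        F = "\<lambda>n. genF M X Y (n + 1) n" and e = "\<lambda>n. L * (\<gamma> (n + 1))\<^sup>2"])
    show "sets (genF M X Y (n + 1) n) \<subseteq> sets (genF M X Y (Suc n + 1) (Suc n))" for n
      by (rule genF_mono) auto
    show "(\<lambda>\<omega>. min (D q (X (n + 1) \<omega>)) c0) \<in> borel_measurable (genF M X Y (n + 1) n)" for n
      by (rule borel_measurable_continuous_on_compose[OF cont_min measurable_genF_left])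
        (use X_in_C in auto)
    show "integrable M (\<lambda>\<omega>. min (D q (X (n + 1) \<omega>)) c0)" for n
      by (rule integrable_X[OF cont_min]) simp
    show "0 \<le> min (D q (X (n + 1) \<omega>)) c0" if "\<omega> \<in> space M" for n \<omega>
      using bregman_nonneg[OF q X_in_C[of "n + 1" \<omega>]] c0 that by simp
    show "(\<integral>\<omega>. indicator A \<omega> * (min (D q (X (Suc n + 1) \<omega>)) c0 - min (D q (X (n + 1) \<omega>)) c0) \<partial>M)
        \<le> L * (\<gamma> (n + 1))\<^sup>2" if "A \<in> sets (genF M X Y (n + 1) n)" for n A
      using L(2)[of "n + 1" A] that by simp
    show "summable (\<lambda>n. L * (\<gamma> (n + 1))\<^sup>2)" by (rule summable_mult[OF step_sq])
  qed (use L(1) ab sub_F in auto)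
qed

text \<open>The squared displacements are dominated by terms whose expectations sum to at most a
  multiple of the sum of the squared steps, so they are almost surely summable.\<close>

lemma AE_displacement_tendsto_0: "AE \<omega> in M. (\<lambda>n. Y (n + 1) \<omega> - X (n + 1) \<omega>) \<longlonglongrightarrow> 0"
proof -
  have "AE \<omega> in M. summable (\<lambda>n. (\<gamma> (n + 1))\<^sup>2 / k\<^sup>2 * (norm (G (n + 1) \<omega>))\<^sup>2)"
  proof (rule AE_summable_of_integral_sums_bounded)
    show "integrable M (\<lambda>\<omega>. (\<gamma> (n + 1))\<^sup>2 / k\<^sup>2 * (norm (G (n + 1) \<omega>))\<^sup>2)" for n
      using int_G[of "n + 1"] by (intro integrable_mult_right) simp
    fix N
    have "(\<Sum>n<N. \<integral>\<omega>. (\<gamma> (n + 1))\<^sup>2 / k\<^sup>2 * (norm (G (n + 1) \<omega>))\<^sup>2 \<partial>M)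
        \<le> (\<Sum>n<N. (\<gamma> (n + 1))\<^sup>2 / k\<^sup>2 * c)"
      unfolding integral_mult_right_zero by (intro sum_mono mult_left_mono bound_G) auto
    also have "\<dots> = c / k\<^sup>2 * (\<Sum>n<N. (\<gamma> (n + 1))\<^sup>2)"
      by (simp add: sum_distrib_left field_simps)
    also have "\<dots> \<le> c / k\<^sup>2 * (\<Sum>n. (\<gamma> (n + 1))\<^sup>2)"
      by (intro mult_left_mono sum_le_suminf step_sq) (use c_nonneg in auto)
    finally show "(\<Sum>n<N. \<integral>\<omega>. (\<gamma> (n + 1))\<^sup>2 / k\<^sup>2 * (norm (G (n + 1) \<omega>))\<^sup>2 \<partial>M)
      \<le> c / k\<^sup>2 * (\<Sum>n. (\<gamma> (n + 1))\<^sup>2)" .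
  qed simp
  then show ?thesis
  proof (rule AE_mp, intro AE_I2 impI)
    fix \<omega> assume \<omega>: "\<omega> \<in> space M"
      and summ: "summable (\<lambda>n. (\<gamma> (n + 1))\<^sup>2 / k\<^sup>2 * (norm (G (n + 1) \<omega>))\<^sup>2)"
    have "(\<lambda>n. (norm (Y (n + 1) \<omega> - X (n + 1) \<omega>))\<^sup>2) \<longlonglongrightarrow> 0"
      by (rule tendsto_sandwich[OF _ _ tendsto_const summable_LIMSEQ_zero[OF summ]])
        (use displacement[OF _ \<omega>] in auto)
    then have "(\<lambda>n. sqrt ((norm (Y (n + 1) \<omega> - X (n + 1) \<omega>))\<^sup>2)) \<longlonglongrightarrow> sqrt 0"
      by (rule tendsto_real_sqrt)
    then show "(\<lambda>n. Y (n + 1) \<omega> - X (n + 1) \<omega>) \<longlonglongrightarrow> 0"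
      by (simp add: tendsto_norm_zero_iff)
  qed
qed

text \<open>Integrate the one-step inequality over the whole space: the expected divergences
  \<open>d n\<close> telescope and are nonnegative, which bounds the sum of the expected weighted
  gaps.\<close>

lemma AE_summable_gap:
  assumes p: "p \<in> C" and MVI: "\<And>y. y \<in> C \<Longrightarrow> g y \<bullet> (y - p) \<ge> 0"
  shows "AE \<omega> in M. summable (\<lambda>n. \<gamma> (n + 1) * (g (Y (n + 1) \<omega>) \<bullet> (Y (n + 1) \<omega> - p)))"
proof (rule AE_summable_of_integral_sums_bounded)
  have int: "integrable M (\<lambda>\<omega>. g (Y (n + 1) \<omega>) \<bullet> (Y (n + 1) \<omega> - p))" for n
    by (rule integrable_Y[OF cont_g_inner]) simp
  then show "integrable M (\<lambda>\<omega>. \<gamma> (n + 1) * (g (Y (n + 1) \<omega>) \<bullet> (Y (n + 1) \<omega> - p)))" for n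
    by simp
  show "0 \<le> \<gamma> (n + 1) * (g (Y (n + 1) \<omega>) \<bullet> (Y (n + 1) \<omega> - p))" if "\<omega> \<in> space M" for n \<omega>
    using step_pos[of "n + 1"] MVI[OF Y_in_C[of "n + 1" \<omega>]] that by simp
  fix N
  have intD: "integrable M (\<lambda>\<omega>. D p (X (n + 1) \<omega>))" for n
    by (rule integrable_X[OF cont_bregman_right[OF p]]) simp
  define d where "d n = (\<integral>\<omega>. D p (X (n + 1) \<omega>) \<partial>M)" for n
  have d: "d n \<ge> 0" for n
    unfolding d_def by (rule integral_nonneg_AE) (use bregman_nonneg[OF p X_in_C[of "n + 1"]] in auto)
  have step: "(\<integral>\<omega>. \<gamma> (n + 1) * (g (Y (n + 1) \<omega>) \<bullet> (Y (n + 1) \<omega> - p)) \<partial>M)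
      \<le> d n - d (Suc n) + 4 * c / k * (\<gamma> (n + 1))\<^sup>2" for n
  proof -
    have "space M \<in> sets (genF M X Y (n + 1) (n + 1))"
      using sets.top[of "genF M X Y (n + 1) (n + 1)"] by simp
    from expected_step[OF _ p this]
    have "(\<integral>\<omega>. indicator (space M) \<omega> * (D p (X (n + 1 + 1) \<omega>) - D p (X (n + 1) \<omega>)) \<partial>M)
      \<le> - \<gamma> (n + 1) * (\<integral>\<omega>. indicator (space M) \<omega> * (g (Y (n + 1) \<omega>) \<bullet> (Y (n + 1) \<omega> - p)) \<partial>M)
        + 4 * c / k * (\<gamma> (n + 1))\<^sup>2" by simp
    moreover have "(\<integral>\<omega>. indicator (space M) \<omega> * f \<omega> \<partial>M) = (\<integral>\<omega>. f \<omega> \<partial>M)" for f :: "'w \<Rightarrow> real"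
      by (rule Bochner_Integration.integral_cong) auto
    ultimately show ?thesis using intD[of n] intD[of "Suc n"] by (simp add: d_def)
  qed
  have "(\<Sum>n<N. \<integral>\<omega>. \<gamma> (n + 1) * (g (Y (n + 1) \<omega>) \<bullet> (Y (n + 1) \<omega> - p)) \<partial>M)
      \<le> (\<Sum>n<N. d n - d (Suc n) + 4 * c / k * (\<gamma> (n + 1))\<^sup>2)"
    by (rule sum_mono) (rule step)
  also have "\<dots> = d 0 - d N + 4 * c / k * (\<Sum>n<N. (\<gamma> (n + 1))\<^sup>2)"
    by (simp only: sum.distrib sum_lessThan_telescope' sum_distrib_left)
  also have "\<dots> \<le> d 0 + 4 * c / k * (\<Sum>n. (\<gamma> (n + 1))\<^sup>2)"
  proof -
    have "4 * c / k * (\<Sum>n<N. (\<gamma> (n + 1))\<^sup>2) \<le> 4 * c / k * (\<Sum>n. (\<gamma> (n + 1))\<^sup>2)"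
      by (intro mult_left_mono sum_le_suminf step_sq) (use c_nonneg k_pos in auto)
    then show ?thesis using d[of N] by linarith
  qed
  finally show "(\<Sum>n<N. \<integral>\<omega>. \<gamma> (n + 1) * (g (Y (n + 1) \<omega>) \<bullet> (Y (n + 1) \<omega> - p)) \<partial>M)
      \<le> d 0 + 4 * c / k * (\<Sum>n. (\<gamma> (n + 1))\<^sup>2)" .
qed

end

section \<open>Deterministic limit arguments along a single sample path\<close>

lemma frequently_small_gap:
  fixes u \<gamma> :: "nat \<Rightarrow> real"
  assumes "\<And>n. \<gamma> n > 0" "\<not> summable \<gamma>" "summable (\<lambda>n. \<gamma> n * u n)" "e > 0"
  shows "\<exists>n\<ge>N. u n < e"
proof (rule ccontr)
  assume "\<not> ?thesis"
  then have *: "e \<le> u n" if "n \<ge> N" for n using that by force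
  have "summable \<gamma>"
  proof (rule summable_comparison_test')
    show "summable (\<lambda>n. \<gamma> n * u n * (1 / e))" by (rule summable_mult2) fact
    show "norm (\<gamma> n) \<le> \<gamma> n * u n * (1 / e)" if "n \<ge> N" for n
      using *[OF that] assms(1)[of n] assms(4) by (simp add: field_simps)
  qed
  then show False using assms(2) by simp
qed

context bregman_geometry
begin

text \<open>Smallness of \<open>u\<close> is seen along \<open>y\<close>, whereas the limit is
  wanted for \<open>x\<close>; the vanishing difference transfers it. In the application
  \<open>u\<close> is the gap \<open>g y \<bullet> (y - p)\<close>.\<close>

lemma accumulation_point:
  fixes x y :: "nat \<Rightarrow> 'v" and u :: "'v \<Rightarrow> real"
  assumes y: "\<And>n. y n \<in> C" and xy: "(\<lambda>n. y n - x n) \<longlonglongrightarrow> 0"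
    and u: "continuous_on C u" "\<And>z. z \<in> C \<Longrightarrow> 0 \<le> u z"
    and small: "\<And>e N. e > 0 \<Longrightarrow> \<exists>n\<ge>N. u (y n) < e"
  obtains z s where "z \<in> C" "u z = 0" "\<And>j. j \<le> s j" "(\<lambda>j. x (s j)) \<longlonglongrightarrow> z"
proof -
  have "\<exists>n\<ge>j. u (y n) < 1 / real (Suc j)" for j by (rule small) simp
  then obtain m where m: "\<And>j. m j \<ge> j" "\<And>j. u (y (m j)) < 1 / real (Suc j)" by metis
  have "seq_compact C" using compact_C by (simp add: compact_eq_seq_compact_metric)
  then obtain z r where z: "z \<in> C" "strict_mono r" "((\<lambda>j. y (m j)) \<circ> r) \<longlonglongrightarrow> z"
    using y by (elim seq_compactE[where f = "\<lambda>j. y (m j)"]) auto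
  \<comment> \<open>\<open>m\<close> need not be monotone, so \<open>s\<close> may fail to be a
    subsequence in the strict sense; \<open>j \<le> s j\<close> is enough for it to tend to
    infinity.\<close>
  define s where "s = m \<circ> r"
  have s: "j \<le> s j" for j
    using m(1)[of "r j"] seq_suble[OF z(2), of j] by (simp add: s_def)
  have y_lim: "(\<lambda>j. y (s j)) \<longlonglongrightarrow> z" using z(3) by (simp add: s_def comp_def)
  have "filterlim s at_top sequentially"
    by (rule filterlim_at_top_mono[OF filterlim_ident]) (simp add: s)
  then have "(\<lambda>j. y (s j) - x (s j)) \<longlonglongrightarrow> 0" by (rule filterlim_compose[OF xy])
  from tendsto_diff[OF y_lim this] have x_lim: "(\<lambda>j. x (s j)) \<longlonglongrightarrow> z" by simp
  have u_lim: "(\<lambda>j. u (y (s j))) \<longlonglongrightarrow> u z"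
    by (rule continuous_on_tendsto_compose[OF u(1) y_lim z(1)]) (simp add: y)
  have "u (y (s j)) \<le> 1 / real (Suc j)" for j
  proof -
    have "u (y (s j)) \<le> 1 / real (Suc (r j))" using m(2)[of "r j"] by (simp add: s_def)
    also have "\<dots> \<le> 1 / real (Suc j)" using seq_suble[OF z(2), of j] by (simp add: frac_le)
    finally show ?thesis .
  qed
  moreover have "(\<lambda>j. 1 / real (Suc j)) \<longlonglongrightarrow> 0" using LIMSEQ_inverse_real_of_nat by (simp add: inverse_eq_divide)
  ultimately have "u z \<le> 0" using u_lim by (intro LIMSEQ_le[of _ _ "\<lambda>j. 1 / real (Suc j)"]) auto
  then have "u z = 0" using u(2)[OF z(1)] by simp
  then show thesis using that z(1) s x_lim by blast
qed

text \<open>The limit \<open>z\<close> may lie outside \<open>Q\<close>, so a nearby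
  \<open>q\<close> replaces it. The path returns infinitely often to \<open>D q < t\<close>; with
  finitely many upcrossings from \<open>t\<close> to \<open>2 * t\<close> it finally stays at or
  below \<open>2 * t\<close>, and strong convexity turns this into closeness in norm.\<close>

lemma converges_if_finite_upcrossings:
  fixes x :: "nat \<Rightarrow> 'v"
  assumes x: "\<And>n. x n \<in> C" and Q: "Q \<subseteq> C" and z: "z \<in> C" "z \<in> closure Q"
    and s: "\<And>j. j \<le> s j" "(\<lambda>j. x (s j)) \<longlonglongrightarrow> z" and c0: "c0 > 0"
    and up: "\<And>q j. q \<in> Q \<Longrightarrow> \<not> ((\<exists>\<^sub>\<infinity>n. min (D q (x n)) c0 < 1 / real (Suc j)) \<and>
                (\<exists>\<^sub>\<infinity>n. min (D q (x n)) c0 > 2 / real (Suc j)))"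
  shows "x \<longlonglongrightarrow> z"
proof (rule LIMSEQ_I)
  fix e :: real assume e: "e > 0"
  have "min (c0 / 2) (k * (e / 2)\<^sup>2 / 4) > 0" using c0 k_pos e by simp
  \<comment> \<open>The first bound keeps the level \<open>2 * t\<close> under the cap
    \<open>c0\<close>. The second makes \<open>D q \<le> 2 * t\<close> imply distance less than
    \<open>e / 2\<close> from \<open>q\<close>.\<close>
  then obtain j where j: "inverse (real (Suc j)) < min (c0 / 2) (k * (e / 2)\<^sup>2 / 4)"
    using reals_Archimedean by blast
  define t where "t = 1 / real (Suc j)"
  have "t < min (c0 / 2) (k * (e / 2)\<^sup>2 / 4)" using j unfolding t_def inverse_eq_divide .
  then have t: "2 * t < c0" "4 * t / k < (e / 2)\<^sup>2" using k_pos by (auto simp: field_simps)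
  have t_pos: "t > 0" unfolding t_def by simp
  obtain q' where q': "\<And>i. q' i \<in> Q" "q' \<longlonglongrightarrow> z"
    using z(2) unfolding closure_sequential by blast
  have "(\<lambda>i. D (q' i) z) \<longlonglongrightarrow> D z z"
    by (rule continuous_on_tendsto_compose[OF cont_bregman_left[OF z(1)] q'(2) z(1)])
      (use q'(1) Q in \<open>auto intro!: always_eventually\<close>)
  then have "eventually (\<lambda>i. D (q' i) z < t) sequentially"
    using t_pos by (intro order_tendstoD(2)) (auto simp: bregman_self)
  moreover have "eventually (\<lambda>i. norm (q' i - z) < e / 2) sequentially"
    using tendstoD[OF q'(2), of "e / 2"] e by (simp add: dist_norm)
  ultimately have "eventually (\<lambda>i. D (q' i) z < t \<and> norm (q' i - z) < e / 2) sequentially"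
    by (rule eventually_conj)
  then obtain i where i: "D (q' i) z < t" "norm (q' i - z) < e / 2"
    unfolding eventually_sequentially by blast
  define q where "q = q' i"
  have q: "q \<in> Q" "q \<in> C" "D q z < t" "norm (q - z) < e / 2"
    using i q'(1) Q by (auto simp: q_def)
  have "(\<lambda>j. D q (x (s j))) \<longlonglongrightarrow> D q z"
    by (rule continuous_on_tendsto_compose[OF cont_bregman_right[OF q(2)] s(2) z(1)]) (simp add: x)
  then have "eventually (\<lambda>j. D q (x (s j)) < t) sequentially"
    using q(3) by (rule order_tendstoD(2))
  then obtain N where N: "\<And>j. j \<ge> N \<Longrightarrow> D q (x (s j)) < t"
    unfolding eventually_sequentially by blast
  have "\<exists>\<^sub>\<infinity>n. min (D q (x n)) c0 < t"
    unfolding INFM_nat_le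
  proof
    fix m
    have "m \<le> s (max m N)" using s(1)[of "max m N"] by simp
    moreover have "min (D q (x (s (max m N)))) c0 < t" using N[of "max m N"] by simp
    ultimately show "\<exists>n\<ge>m. min (D q (x n)) c0 < t" by blast
  qed
  then have "\<not> (\<exists>\<^sub>\<infinity>n. min (D q (x n)) c0 > 2 * t)" using up[OF q(1), of j] by (simp add: t_def)
  then obtain N where N: "\<And>n. n \<ge> N \<Longrightarrow> min (D q (x n)) c0 \<le> 2 * t"
    unfolding INFM_nat_le not_all not_ex not_less by (metis not_less)
  have "norm (x n - z) < e" if "n \<ge> N" for n
  proof -
    have "D q (x n) \<le> 2 * t" using N[OF that] t(1) by (simp add: min_def split: if_splits)
    then have "k / 2 * (norm (q - x n))\<^sup>2 \<le> 2 * t" using bregman_lower[OF q(2) x[of n]] by linarith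
    then have "(norm (q - x n))\<^sup>2 \<le> 4 * t / k" using k_pos by (simp add: field_simps)
    then have "(norm (q - x n))\<^sup>2 < (e / 2)\<^sup>2" using t(2) by linarith
    then have "norm (q - x n) < e / 2" by (rule power_less_imp_less_base) (use e in simp)
    moreover have "norm (x n - z) \<le> norm (q - x n) + norm (q - z)"
      using norm_triangle_ineq4[of "q - z" "q - x n"] by simp
    ultimately show ?thesis using q(4) by linarith
  qed
  then show "\<exists>N. \<forall>n\<ge>N. norm (x n - z) < e" by blast
qed

text \<open>The quantifier over the uncountable set \<open>S\<close> becomes countable by compactness: it suffices
  to satisfy ever longer finite stretches up to a vanishing error on a dense subset of \<open>S\<close>.\<close>

lemma eventually_near_iff:
  assumes S: "compact S" "S \<subseteq> C" and Q: "Q \<subseteq> S" "S \<subseteq> closure Q" and x: "\<And>n. n > n0 \<Longrightarrow> x n \<in> C"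
  shows "(\<exists>z\<in>S. \<forall>n>n0. D z (x n) \<le> \<epsilon>) \<longleftrightarrow>
    (\<forall>N. \<exists>q\<in>Q. \<forall>n\<in>{n0<..N}. D q (x n) < \<epsilon> + 1 / real (Suc N))" (is "?L \<longleftrightarrow> ?R")
proof
  assume ?L
  then obtain z where z: "z \<in> S" "\<And>n. n > n0 \<Longrightarrow> D z (x n) \<le> \<epsilon>" by blast
  obtain q where q: "\<And>i. q i \<in> Q" "q \<longlonglongrightarrow> z"
    using z(1) Q(2) unfolding closure_sequential[symmetric] by (metis closure_sequential subsetD)
  show ?R
  proof
    fix N
    have "eventually (\<lambda>i. D (q i) (x n) < \<epsilon> + 1 / real (Suc N)) sequentially" if "n \<in> {n0<..N}" for n
    proof (rule order_tendstoD(2))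
      show "(\<lambda>i. D (q i) (x n)) \<longlonglongrightarrow> D z (x n)"
        by (rule continuous_on_tendsto_compose[OF cont_bregman_left q(2)])
          (use x that z(1) q(1) Q(1) S(2) in \<open>auto intro!: always_eventually\<close>)
      have "D z (x n) \<le> \<epsilon>" using z(2) that by simp
      also have "\<epsilon> < \<epsilon> + 1 / real (Suc N)" by simp
      finally show "D z (x n) < \<epsilon> + 1 / real (Suc N)" .
    qed
    then have "eventually (\<lambda>i. \<forall>n\<in>{n0<..N}. D (q i) (x n) < \<epsilon> + 1 / real (Suc N)) sequentially"
      by (intro eventually_ball_finite) auto
    then obtain i where "\<forall>n\<in>{n0<..N}. D (q i) (x n) < \<epsilon> + 1 / real (Suc N)"
      unfolding eventually_sequentially by blast
    then show "\<exists>q\<in>Q. \<forall>n\<in>{n0<..N}. D q (x n) < \<epsilon> + 1 / real (Suc N)" using q(1) by blast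
  qed
next
  assume ?R
  then obtain q where q: "\<And>N. q N \<in> Q" "\<And>N n. n \<in> {n0<..N} \<Longrightarrow> D (q N) (x n) < \<epsilon> + 1 / real (Suc N)"
    by metis
  have "seq_compact S" using S(1) by (simp add: compact_eq_seq_compact_metric)
  then obtain z r where z: "z \<in> S" "strict_mono r" "(q \<circ> r) \<longlonglongrightarrow> z"
    using q(1) Q(1) by (elim seq_compactE[where f = q]) auto
  have "D z (x n) \<le> \<epsilon>" if n: "n > n0" for n
  proof (rule LIMSEQ_le)
    show "(\<lambda>N. D ((q \<circ> r) N) (x n)) \<longlonglongrightarrow> D z (x n)"
      by (rule continuous_on_tendsto_compose[OF cont_bregman_left z(3)])
        (use x n z(1) q(1) Q(1) S(2) in \<open>auto intro!: always_eventually\<close>)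
    have "(\<lambda>N. \<epsilon> + inverse (real (Suc N))) \<longlonglongrightarrow> \<epsilon> + 0"
      by (intro tendsto_intros LIMSEQ_inverse_real_of_nat)
    then show "(\<lambda>N. \<epsilon> + 1 / real (Suc N)) \<longlonglongrightarrow> \<epsilon>" by (simp add: inverse_eq_divide)
    have "D ((q \<circ> r) N) (x n) \<le> \<epsilon> + 1 / real (Suc N)" if "N \<ge> n" for N
    proof -
      have "N \<le> r N" by (rule seq_suble[OF z(2)])
      then have "D (q (r N)) (x n) < \<epsilon> + 1 / real (Suc (r N))" using n that by (intro q(2)) auto
      also have "\<dots> \<le> \<epsilon> + 1 / real (Suc N)" using \<open>N \<le> r N\<close> by (simp add: frac_le)
      finally show ?thesis by simp
    qed
    then show "\<exists>N0. \<forall>N\<ge>N0. D ((q \<circ> r) N) (x n) \<le> \<epsilon> + 1 / real (Suc N)" by blast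
  qed
  then show ?L using z(1) by blast
qed

end

section \<open>Almost sure convergence and measurability of the limiting event\<close>

context extragradient
begin

text \<open>The accumulation point depends on the path, so the exceptional null set must be fixed
  before it is known. This is why both the reference points and the levels
  \<open>1 / real (Suc j)\<close>, \<open>2 / real (Suc j)\<close> range over countable
  families.\<close>

theorem AE_converges:
  assumes S: "S \<subseteq> C" and p: "p \<in> C"
    and MVI: "\<And>y. y \<in> C \<Longrightarrow> g y \<bullet> (y - p) \<ge> 0"
    and strict: "\<And>y. y \<in> C \<Longrightarrow> g y \<bullet> (y - p) = 0 \<Longrightarrow> y \<in> S"
    and c0: "c0 > 0"
    and local: "\<And>q y. q \<in> S \<Longrightarrow> y \<in> C \<Longrightarrow> D q y \<le> 2 * c0 \<Longrightarrow> g y \<bullet> (y - q) \<ge> 0"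
    and div: "\<not> summable (\<lambda>n. \<gamma> (n + 1))"
  shows "AE \<omega> in M. \<exists>z\<in>S. (\<lambda>n. X (n + 1) \<omega>) \<longlonglongrightarrow> z"
proof -
  obtain Q where Q: "countable Q" "Q \<subseteq> S" "S \<subseteq> closure Q" using separable by blast
  have "AE \<omega> in M. \<forall>q\<in>Q. \<forall>j. \<not> ((\<exists>\<^sub>\<infinity>n. min (D q (X (n + 1) \<omega>)) c0 < 1 / real (Suc j)) \<and>
      (\<exists>\<^sub>\<infinity>n. min (D q (X (n + 1) \<omega>)) c0 > 2 / real (Suc j)))"
    unfolding AE_ball_countable[OF Q(1)] AE_all_countable
  proof (intro ballI allI)
    fix q j assume "q \<in> Q"
    then have "q \<in> S" "q \<in> C" using Q(2) S by auto
    then show "AE \<omega> in M. \<not> ((\<exists>\<^sub>\<infinity>n. min (D q (X (n + 1) \<omega>)) c0 < 1 / real (Suc j)) \<and>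
      (\<exists>\<^sub>\<infinity>n. min (D q (X (n + 1) \<omega>)) c0 > 2 / real (Suc j)))"
      by (intro AE_finite_upcrossings c0 local) (auto simp: divide_strict_right_mono)
  qed
  moreover have "AE \<omega> in M. summable (\<lambda>n. \<gamma> (n + 1) * (g (Y (n + 1) \<omega>) \<bullet> (Y (n + 1) \<omega> - p)))"
    by (rule AE_summable_gap[OF p MVI])
  ultimately show ?thesis
    using AE_displacement_tendsto_0 AE_space
  proof eventually_elim
    case (elim \<omega>)
    have XC: "X (n + 1) \<omega> \<in> C" and YC: "Y (n + 1) \<omega> \<in> C" for n
      using X_in_C Y_in_C elim(4) by simp_all
    obtain z s where z: "z \<in> C" "g z \<bullet> (z - p) = 0" and s: "\<And>j. j \<le> s j" "(\<lambda>j. X (s j + 1) \<omega>) \<longlonglongrightarrow> z"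
    proof (rule accumulation_point[where y = "\<lambda>n. Y (n + 1) \<omega>" and x = "\<lambda>n. X (n + 1) \<omega>" and u = "\<lambda>y. g y \<bullet> (y - p)"])
      show "\<exists>n\<ge>N. g (Y (n + 1) \<omega>) \<bullet> (Y (n + 1) \<omega> - p) < e" if "e > 0" for e N
        by (rule frequently_small_gap[OF _ div elim(2) that]) (simp add: step_pos)
    qed (use YC elim(3) cont_g_inner MVI in auto)
    have "z \<in> S" by (rule strict[OF z])
    moreover have "(\<lambda>n. X (n + 1) \<omega>) \<longlonglongrightarrow> z"
      by (rule converges_if_finite_upcrossings[OF XC _ z(1) _ s c0, where Q = Q])
        (use elim(1) Q S \<open>z \<in> S\<close> in auto)
    ultimately show ?case by blast
  qed
qed

text \<open>\<open>measure\<close> is 0 on non-measurable sets, so a lower bound on the probability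
  requires this. Replacing \<open>S\<close> by a countable dense subset expresses the event through
  countably many conditions on single iterates.\<close>

lemma eventually_near_measurable:
  assumes S: "compact S" "S \<subseteq> C"
  shows "{\<omega> \<in> space M. \<exists>n0. \<exists>z\<in>S. \<forall>n\<ge>n0. D z (X n \<omega>) \<le> \<epsilon>} \<in> sets M"
proof -
  obtain Q where Q: "countable Q" "Q \<subseteq> S" "S \<subseteq> closure Q" using separable by blast
  have ge_iff: "(\<exists>n0. \<exists>z\<in>S. \<forall>n\<ge>n0. P z n) \<longleftrightarrow> (\<exists>n0. \<exists>z\<in>S. \<forall>n>n0. P z n)" for P :: "'v \<Rightarrow> nat \<Rightarrow> bool"
    by (meson Suc_leD Suc_le_eq less_imp_le order_refl)
  have "{\<omega> \<in> space M. \<exists>n0. \<forall>N. \<exists>q\<in>Q. \<forall>n\<in>{n0<..N}. D q (X n \<omega>) < \<epsilon> + 1 / real (Suc N)} \<in> sets M"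
  proof (intro sets.sets_Collect_countable_Ex sets.sets_Collect_countable_All
      sets.sets_Collect_countable_Ex' sets.sets_Collect_finite_All ballI Q(1))
    fix n0 N n :: nat and q assume "q \<in> Q" "n \<in> {n0<..N}"
    then have "q \<in> C" "n \<ge> 1" using Q(2) S(2) by auto
    from borel_measurable_continuous_on_compose[OF cont_bregman_right[OF this(1)] X_M X_in_C[OF this(2)]]
    have "(\<lambda>\<omega>. D q (X n \<omega>)) \<in> borel_measurable M" by simp
    then show "{\<omega> \<in> space M. D q (X n \<omega>) < \<epsilon> + 1 / real (Suc N)} \<in> sets M"
      by (rule borel_measurable_less) simp
  qed simp
  moreover have "(\<exists>z\<in>S. \<forall>n>n0. D z (X n \<omega>) \<le> \<epsilon>) \<longleftrightarrow>
    (\<forall>N. \<exists>q\<in>Q. \<forall>n\<in>{n0<..N}. D q (X n \<omega>) < \<epsilon> + 1 / real (Suc N))" if "\<omega> \<in> space M" for \<omega> n0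
    by (rule eventually_near_iff[OF S Q(2,3)]) (use X_in_C that in auto)
  ultimately show ?thesis unfolding ge_iff by (simp cong: conj_cong)
qed

theorem prob_eventually_near:
  assumes S: "compact S" "S \<subseteq> C" and \<epsilon>: "\<epsilon> > 0"
    and conv: "AE \<omega> in M. \<exists>z\<in>S. (\<lambda>n. X (n + 1) \<omega>) \<longlonglongrightarrow> z"
  shows "prob {\<omega> \<in> space M. \<exists>n0. \<exists>z\<in>S. \<forall>n\<ge>n0. D z (X n \<omega>) \<le> \<epsilon>} = 1"
  unfolding prob_Collect_eq_1[OF eventually_near_measurable[OF S]]
  using conv AE_space
proof eventually_elim
  case (elim \<omega>)
  then obtain z where z: "z \<in> S" "(\<lambda>n. X (n + 1) \<omega>) \<longlonglongrightarrow> z" by blast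
  have "(\<lambda>n. D z (X (n + 1) \<omega>)) \<longlonglongrightarrow> D z z"
    by (rule continuous_on_tendsto_compose[OF cont_bregman_right z(2)])
      (use z(1) S(2) X_in_C elim(2) in auto)
  then have "eventually (\<lambda>n. D z (X (n + 1) \<omega>) < \<epsilon>) sequentially"
    using \<epsilon> by (intro order_tendstoD(2)) (auto simp: bregman_self)
  then obtain N where N: "\<And>n. n \<ge> N \<Longrightarrow> D z (X (n + 1) \<omega>) < \<epsilon>"
    unfolding eventually_sequentially by blast
  have "D z (X n \<omega>) \<le> \<epsilon>" if "n \<ge> N + 1" for n
    using N[of "n - 1"] that by (simp add: less_imp_le)
  then show ?case using z(1) by blast
qed

end

section \<open>Saddle points\<close>

text \<open>Integrating the conditional bound removes the conditioning, and \<open>dom\<close>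
  passes from \<psi>, later the dual norm, to the Euclidean norm. Nonnegative integrals are used so
  that square integrability is a result and not a premise.\<close>

lemma (in prob_space) second_moment_bound:
  fixes Z :: "'a \<Rightarrow> 'v::euclidean_space" and \<psi> :: "'v \<Rightarrow> real"
  assumes sub: "subalgebra M F" and Z [measurable]: "Z \<in> borel_measurable M"
    and \<psi> [measurable]: "\<psi> \<in> borel_measurable borel" and dom: "\<And>z. norm z \<le> B * \<psi> z"
    and bound: "AE \<omega> in M. nn_cond_exp M F (\<lambda>\<omega>. ennreal ((\<psi> (Z \<omega>))\<^sup>2)) \<omega> \<le> ennreal (G\<^sup>2)"
  shows "integrable M (\<lambda>\<omega>. (norm (Z \<omega>))\<^sup>2)" and "(\<integral>\<omega>. (norm (Z \<omega>))\<^sup>2 \<partial>M) \<le> B\<^sup>2 * G\<^sup>2"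
proof -
  interpret S: finite_measure_subalgebra M F by unfold_locales (rule sub)
  have "(\<integral>\<^sup>+\<omega>. ennreal ((norm (Z \<omega>))\<^sup>2) \<partial>M) \<le> (\<integral>\<^sup>+\<omega>. ennreal (B\<^sup>2) * ennreal ((\<psi> (Z \<omega>))\<^sup>2) \<partial>M)"
  proof (rule nn_integral_mono)
    fix \<omega>
    have "(norm (Z \<omega>))\<^sup>2 \<le> (B * \<psi> (Z \<omega>))\<^sup>2" by (rule power_mono[OF dom]) simp
    then show "ennreal ((norm (Z \<omega>))\<^sup>2) \<le> ennreal (B\<^sup>2) * ennreal ((\<psi> (Z \<omega>))\<^sup>2)"
      by (simp add: ennreal_mult[symmetric] power_mult_distrib ennreal_leI)
  qed
  also have "\<dots> = ennreal (B\<^sup>2) * (\<integral>\<^sup>+\<omega>. ennreal ((\<psi> (Z \<omega>))\<^sup>2) \<partial>M)"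
    by (rule nn_integral_cmult) measurable
  also have "(\<integral>\<^sup>+\<omega>. ennreal ((\<psi> (Z \<omega>))\<^sup>2) \<partial>M) = (\<integral>\<^sup>+\<omega>. nn_cond_exp M F (\<lambda>\<omega>. ennreal ((\<psi> (Z \<omega>))\<^sup>2)) \<omega> \<partial>M)"
    using S.nn_cond_exp_intg[of "\<lambda>_. 1" "\<lambda>\<omega>. ennreal ((\<psi> (Z \<omega>))\<^sup>2)"] by simp
  also have "\<dots> \<le> (\<integral>\<^sup>+\<omega>. ennreal (G\<^sup>2) \<partial>M)" by (rule nn_integral_mono_AE[OF bound])
  also have "\<dots> = ennreal (G\<^sup>2)" by (simp add: emeasure_space_1)
  finally have le: "(\<integral>\<^sup>+\<omega>. ennreal ((norm (Z \<omega>))\<^sup>2) \<partial>M) \<le> ennreal (B\<^sup>2 * G\<^sup>2)"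
    by (simp add: ennreal_mult mult_left_mono)
  show int: "integrable M (\<lambda>\<omega>. (norm (Z \<omega>))\<^sup>2)"
    by (rule integrableI_nonneg) (use le in \<open>auto simp: less_top[symmetric] top_unique\<close>)
  have "ennreal (\<integral>\<omega>. (norm (Z \<omega>))\<^sup>2 \<partial>M) \<le> ennreal (B\<^sup>2 * G\<^sup>2)"
    using le nn_integral_eq_integral[OF int] by simp
  then show "(\<integral>\<omega>. (norm (Z \<omega>))\<^sup>2 \<partial>M) \<le> B\<^sup>2 * G\<^sup>2" by (simp add: ennreal_le_iff)
qed

lemma saddle_points_iff:
  "z \<in> saddle_points f X1 X2 \<longleftrightarrow> z \<in> X1 \<times> X2 \<and>
    (\<forall>x2\<in>X2. f (fst z, x2) \<le> f z) \<and> (\<forall>x1\<in>X1. f z \<le> f (x1, snd z))"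
  unfolding saddle_points_def by (cases z) auto

text \<open>For fixed competitors the defining inequalities compare continuous functions and so
  survive limits. Compactness keeps the limit of approximating saddle points inside the set when
  measurability is proved.\<close>

lemma compact_saddle_points:
  fixes f :: "'a::metric_space \<times> 'b::metric_space \<Rightarrow> real"
  assumes "compact X1" "compact X2" "continuous_on (X1 \<times> X2) f"
  shows "compact (saddle_points f X1 X2)"
proof -
  have cont1: "continuous_on (X1 \<times> X2) (\<lambda>z. f (fst z, x2))" if "x2 \<in> X2" for x2
    by (rule continuous_on_compose2[OF assms(3)]) (use that in \<open>auto intro!: continuous_intros\<close>)
  have cont2: "continuous_on (X1 \<times> X2) (\<lambda>z. f (x1, snd z))" if "x1 \<in> X1" for x1
    by (rule continuous_on_compose2[OF assms(3)]) (use that in \<open>auto intro!: continuous_intros\<close>)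
  have sub: "saddle_points f X1 X2 \<subseteq> X1 \<times> X2" by (auto simp: saddle_points_iff)
  have "closed (saddle_points f X1 X2)"
    unfolding closed_sequential_limits
  proof (intro allI impI, elim conjE)
    fix s z assume s: "\<forall>n. s n \<in> saddle_points f X1 X2" and lim: "s \<longlonglongrightarrow> z"
    have sC: "s n \<in> X1 \<times> X2" for n using s sub by blast
    have "closed (X1 \<times> X2)" using assms by (intro compact_imp_closed compact_Times)
    then have z: "z \<in> X1 \<times> X2" using sC lim closed_sequentially by blast
    have along: "(\<lambda>n. \<phi> (s n)) \<longlonglongrightarrow> \<phi> z" if "continuous_on (X1 \<times> X2) \<phi>" for \<phi> :: "_ \<Rightarrow> real"
      by (rule continuous_on_tendsto_compose[OF that lim z]) (use sC in \<open>auto intro!: always_eventually\<close>)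
    have "f (fst z, x2) \<le> f z" if "x2 \<in> X2" for x2
      by (rule LIMSEQ_le[OF along[OF cont1[OF that]] along[OF assms(3)]])
        (use s that in \<open>auto simp: saddle_points_iff\<close>)
    moreover have "f z \<le> f (x1, snd z)" if "x1 \<in> X1" for x1
      by (rule LIMSEQ_le[OF along[OF assms(3)] along[OF cont2[OF that]]])
        (use s that in \<open>auto simp: saddle_points_iff\<close>)
    ultimately show "z \<in> saddle_points f X1 X2" using z by (simp add: saddle_points_iff)
  qed
  then show ?thesis using compact_Int_closed[OF compact_Times[OF assms(1,2)]] sub by (metis inf.absorb2)
qed

theorem theorem3:
  fixes X1 :: "(real^'d1) set" and X2 :: "(real^'d2) set"
    and nrm :: "(real^'d1) \<times> (real^'d2) \<Rightarrow> real"
    and f :: "(real^'d1) \<times> (real^'d2) \<Rightarrow> real"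
    and fgrad :: "(real^'d1) \<times> (real^'d2) \<Rightarrow> (real^'d1) \<times> (real^'d2)"
    and h :: "(real^'d1) \<times> (real^'d2) \<Rightarrow> real"
    and gh :: "(real^'d1) \<times> (real^'d2) \<Rightarrow> (real^'d1) \<times> (real^'d2)"
    and Dh :: "((real^'d1) \<times> (real^'d2)) set"
    and K Lh :: real
    and M :: "'w measure"
    and Xn Yn ghat rhat :: "nat \<Rightarrow> 'w \<Rightarrow> (real^'d1) \<times> (real^'d2)"
    and \<gamma> :: "nat \<Rightarrow> real"
    and G \<sigma> \<epsilon> \<delta> :: real
  assumes X1: "compact X1" "convex X1"
    and X2: "compact X2" "convex X2"
    and norm: "is_norm nrm"
    and f_C1: "\<forall>x\<in>X1 \<times> X2. (f has_derivative (\<lambda>v. fgrad x \<bullet> v)) (at x within X1 \<times> X2)"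
              "continuous_on (X1 \<times> X2) fgrad"
    and h_dom: "X1 \<times> X2 \<subseteq> Dh"
    and h_diff: "\<forall>x\<in>Dh. (h has_derivative (\<lambda>v. gh x \<bullet> v)) (at x within Dh)"
    and K_pos: "K > 0"
    and h_strong: "\<forall>x\<in>Dh. \<forall>x'\<in>Dh. (gh x - gh x') \<bullet> (x - x') \<ge> K * (nrm (x - x'))\<^sup>2"
    and h_lip: "\<forall>x\<in>Dh. \<forall>x'\<in>Dh. dual_norm nrm (gh x - gh x') \<le> Lh * nrm (x - x')"
    and reciprocity: "\<forall>p\<in>X1 \<times> X2. \<forall>xs. (\<forall>n. xs n \<in> X1 \<times> X2) \<longrightarrow> xs \<longlonglongrightarrow> p
                        \<longrightarrow> (\<lambda>n. bregman h gh p (xs n)) \<longlonglongrightarrow> 0"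
    and coherent: "strictly_coherent f (sp_field fgrad) X1 X2 (bregman h gh)"
    and M: "prob_space M"
    and meas: "\<forall>n. Xn n \<in> borel_measurable M \<and> Yn n \<in> borel_measurable M \<and>
                   ghat n \<in> borel_measurable M \<and> rhat n \<in> borel_measurable M"
    and init: "\<forall>\<omega>\<in>space M. Xn 1 \<omega> \<in> X1 \<times> X2"
    and alg_Y: "\<forall>n\<ge>1. \<forall>\<omega>\<in>space M. Yn n \<omega> = prox (X1 \<times> X2) h gh (Xn n \<omega>) (- (\<gamma> n *\<^sub>R ghat n \<omega>))"
    and alg_X: "\<forall>n\<ge>1. \<forall>\<omega>\<in>space M. Xn (n + 1) \<omega> = prox (X1 \<times> X2) h gh (Xn n \<omega>) (- (\<gamma> n *\<^sub>R rhat n \<omega>))"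
    and G: "G \<ge> 0"
    and unbiased_g: "\<forall>n\<ge>1. cond_exp_is M (genF M Xn Yn n (n - 1)) (ghat n)
                                  (\<lambda>\<omega>. sp_field fgrad (Xn n \<omega>))"
    and unbiased_r: "\<forall>n\<ge>1. cond_exp_is M (genF M Xn Yn n n) (rhat n)
                                  (\<lambda>\<omega>. sp_field fgrad (Yn n \<omega>))"
    and second_g: "\<forall>n\<ge>1. AE \<omega> in M. nn_cond_exp M (genF M Xn Yn n (n - 1))
                      (\<lambda>\<omega>. ennreal ((dual_norm nrm (ghat n \<omega>))\<^sup>2)) \<omega> \<le> ennreal (G\<^sup>2)"
    and second_r: "\<forall>n\<ge>1. AE \<omega> in M. nn_cond_exp M (genF M Xn Yn n n)
                      (\<lambda>\<omega>. ennreal ((dual_norm nrm (rhat n \<omega>))\<^sup>2)) \<omega> \<le> ennreal (G\<^sup>2)"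
    and var_g: "\<forall>n\<ge>1. AE \<omega> in M. nn_cond_exp M (genF M Xn Yn n (n - 1))
                      (\<lambda>\<omega>. ennreal ((dual_norm nrm (ghat n \<omega> - sp_field fgrad (Xn n \<omega>)))\<^sup>2)) \<omega>
                      \<le> ennreal (\<sigma>\<^sup>2)"
    and var_r: "\<forall>n\<ge>1. AE \<omega> in M. nn_cond_exp M (genF M Xn Yn n n)
                      (\<lambda>\<omega>. ennreal ((dual_norm nrm (rhat n \<omega> - sp_field fgrad (Yn n \<omega>)))\<^sup>2)) \<omega>
                      \<le> ennreal (\<sigma>\<^sup>2)"
    and eps: "\<epsilon> > 0"
    and delta: "0 < \<delta>" "\<delta> < 1"
    and step_pos: "\<forall>n\<ge>1. \<gamma> n > 0"
    and step_div: "\<not> summable (\<lambda>n. \<gamma> (n + 1))"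
    and step_sq: "summable (\<lambda>n. (\<gamma> (n + 1))\<^sup>2)"
    and step_bound1: "3 * (diam_nrm nrm (X1 \<times> X2))\<^sup>2 * \<sigma>\<^sup>2 * (\<Sum>n. (\<gamma> (n + 1))\<^sup>2) \<le> \<delta> * \<epsilon>\<^sup>2"
    and step_bound2: "3 * \<sigma>\<^sup>2 * (\<Sum>n. (\<gamma> (n + 1))\<^sup>2) \<le> K * \<delta> * \<epsilon>"
  shows "measure M {\<omega> \<in> space M. \<exists>n0::nat. \<exists>xs\<in>saddle_points f X1 X2.
             \<forall>n\<ge>n0. bregman h gh xs (Xn n \<omega>) \<le> \<epsilon>} \<ge> 1 - \<delta>"
proof -
  define C where "C = X1 \<times> X2"
  define g where "g = sp_field fgrad"
  define S where "S = saddle_points f X1 X2"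
  obtain B where B: "\<And>y. norm y \<le> B * dual_norm nrm y" "B > 0" using norm_le_dual_norm[OF norm] by blast
  obtain b where b: "\<And>x. nrm x \<le> b * norm x" "b > 0" using is_norm_upper[OF norm] by blast
  obtain a where a: "\<And>x. a * norm x \<le> nrm x" "a > 0" using is_norm_lower[OF norm] by blast
  have "norm (gh x - gh y) \<le> B * \<bar>Lh\<bar> * b * norm (x - y)" if "x \<in> C" "y \<in> C" for x y
  proof -
    have "norm (gh x - gh y) \<le> B * dual_norm nrm (gh x - gh y)" by (rule B(1))
    also have "\<dots> \<le> B * (Lh * nrm (x - y))"
      using h_lip h_dom that B(2) by (intro mult_left_mono) (auto simp: C_def)
    also have "\<dots> \<le> B * (\<bar>Lh\<bar> * (b * norm (x - y)))"
    proof (intro mult_left_mono mult_mono b)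
      show "0 \<le> nrm (x - y)" using norm unfolding is_norm_def by blast
    qed (use B(2) in auto)
    finally show ?thesis by (simp add: mult.assoc)
  qed
  then have "(B * \<bar>Lh\<bar> * b)-lipschitz_on C gh"
    using B(2) b(2) by (intro lipschitz_onI) (auto simp: dist_norm)
  then have cont_gh: "continuous_on C gh" by (rule lipschitz_on_continuous_on)
  \<comment> \<open>The modulus is \<open>K * a\<^sup>2\<close> because \<open>nrm\<close> dominates
    \<open>a\<close> times the Euclidean norm and enters squared.\<close>
  interpret bregman_geometry C h gh "K * a\<^sup>2"
  proof
    show "compact C" "convex C" unfolding C_def by (intro compact_Times convex_Times X1 X2)+
    show "(h has_derivative (\<bullet>) (gh x)) (at x within C)" if "x \<in> C" for x
      by (rule has_derivative_subset[of _ _ _ Dh]) (use h_diff h_dom that in \<open>auto simp: C_def\<close>)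
    show "K * a\<^sup>2 * (norm (x - y))\<^sup>2 \<le> (gh x - gh y) \<bullet> (x - y)" if "x \<in> C" "y \<in> C" for x y
    proof -
      have "(a * norm (x - y))\<^sup>2 \<le> (nrm (x - y))\<^sup>2"
        by (rule power_mono[OF a(1)]) (use a(2) in simp)
      then have "K * a\<^sup>2 * (norm (x - y))\<^sup>2 \<le> K * (nrm (x - y))\<^sup>2"
        using K_pos by (simp add: power_mult_distrib)
      also have "\<dots> \<le> (gh x - gh y) \<bullet> (x - y)"
        using h_strong h_dom that by (auto simp: C_def)
      finally show ?thesis .
    qed
  qed (use cont_gh K_pos a(2) in auto)
  interpret prob_space M by (rule M)
  have Xn_M: "Xn n \<in> borel_measurable M" and Yn_M: "Yn n \<in> borel_measurable M"
    and ghat_M: "ghat n \<in> borel_measurable M" and rhat_M: "rhat n \<in> borel_measurable M" for n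
    using meas by auto
  have sub: "subalgebra M (genF M Xn Yn n m)" for n m by (intro subalgebra_genF Xn_M Yn_M)
  have moments_g: "integrable M (\<lambda>\<omega>. (norm (ghat n \<omega>))\<^sup>2)" "(\<integral>\<omega>. (norm (ghat n \<omega>))\<^sup>2 \<partial>M) \<le> B\<^sup>2 * G\<^sup>2"
    if "n \<ge> 1" for n
    by (rule second_moment_bound[OF sub ghat_M borel_measurable_dual_norm[OF norm] B(1)
        second_g[rule_format, OF that]])+
  have moments_r: "integrable M (\<lambda>\<omega>. (norm (rhat n \<omega>))\<^sup>2)" "(\<integral>\<omega>. (norm (rhat n \<omega>))\<^sup>2 \<partial>M) \<le> B\<^sup>2 * G\<^sup>2"
    if "n \<ge> 1" for n
    by (rule second_moment_bound[OF sub rhat_M borel_measurable_dual_norm[OF norm] B(1)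
        second_r[rule_format, OF that]])+
  have cont_g: "continuous_on C g"
    unfolding g_def sp_field_def C_def by (intro continuous_intros f_C1(2))
  interpret extragradient C h gh "K * a\<^sup>2" M Xn Yn ghat rhat \<gamma> g "B\<^sup>2 * G\<^sup>2"
  proof
    show "Xn 1 \<omega> \<in> C" if "\<omega> \<in> space M" for \<omega> using init that by (simp add: C_def)
    show "Yn n \<omega> = prox C h gh (Xn n \<omega>) (- (\<gamma> n *\<^sub>R ghat n \<omega>))" if "n \<ge> 1" "\<omega> \<in> space M" for n \<omega>
      using alg_Y that by (simp add: C_def)
    show "Xn (n + 1) \<omega> = prox C h gh (Xn n \<omega>) (- (\<gamma> n *\<^sub>R rhat n \<omega>))" if "n \<ge> 1" "\<omega> \<in> space M" for n \<omega>
      using alg_X that by (simp add: C_def)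
    show "cond_exp_is M (genF M Xn Yn n n) (rhat n) (\<lambda>\<omega>. g (Yn n \<omega>))" if "n \<ge> 1" for n
      using unbiased_r that by (simp add: g_def)
    show "\<gamma> n > 0" if "n \<ge> 1" for n using step_pos that by simp
  qed (fact Xn_M Yn_M cont_g moments_g moments_r step_sq)+
  have S: "compact S" "S \<subseteq> C"
  proof -
    have "continuous_on (X1 \<times> X2) f"
      by (rule has_derivative_continuous_on[OF f_C1(1)[rule_format]])
    then show "compact S" unfolding S_def by (intro compact_saddle_points X1 X2)
    show "S \<subseteq> C" by (auto simp: S_def C_def saddle_points_def)
  qed
  obtain p where p: "p \<in> S" "\<And>x. x \<in> C \<Longrightarrow> g x \<bullet> (x - p) \<ge> 0"
    "\<And>x. x \<in> C \<Longrightarrow> x \<notin> S \<Longrightarrow> g x \<bullet> (x - p) > 0"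
    using coherent unfolding strictly_coherent_def S_def C_def g_def by blast
  obtain \<epsilon>0 where \<epsilon>0: "\<epsilon>0 > 0" "\<And>q x. q \<in> S \<Longrightarrow> x \<in> C \<Longrightarrow> D q x \<le> \<epsilon>0 \<Longrightarrow> g x \<bullet> (x - q) \<ge> 0"
    using coherent unfolding strictly_coherent_def S_def C_def g_def by blast
  have "AE \<omega> in M. \<exists>z\<in>S. (\<lambda>n. Xn (n + 1) \<omega>) \<longlonglongrightarrow> z"
  \<comment> \<open>Half of the coherence radius, since the truncation at \<open>c0\<close> relies
    on the local inequality up to \<open>2 * c0\<close>, which is then \<epsilon>0.\<close>
  proof (rule AE_converges[where p = p and ?c0.0 = "\<epsilon>0 / 2"])
    show "y \<in> S" if "y \<in> C" "g y \<bullet> (y - p) = 0" for y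
      using p(3)[of y] that by fastforce
  qed (use S p \<epsilon>0 step_div in auto)
  from prob_eventually_near[OF S eps this]
  show ?thesis using delta unfolding S_def by simp
qed

end
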